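(* Let $G$ and $H$ be finite digraphs, let $k\ge 2$, and for each $x\in V(G)$ let $L(x)\subseteq V(H)$ be a list. Suppose $h$ is a minority homomorphism of $G\times H^k$ to $H$ consistent with the lists $L$. Then the existence of an $L$-homomorphism of $G$ to $H$ can be decided in polynomial time.
   Context: For a digraph $D$, $V(D)$ is its vertex set and $A(D)$ its arc set; $uv$ denotes the arc $(u,v)$. A function $h$ assigning to each $x\in V(G)$ and each $k$-tuple $a_1,\dots,a_k\in L(x)$ a vertex $h(x;a_1,\dots,a_k)\in V(H)$ is a homomorphism of $G\times H^k$ to $H$ consistent with $L$ if: (List property) $h(x;a_1,\dots,a_k)\in L(x)$ for all $x$ and $a_1,\dots,a_k\in L(x)$; (Adjacency property) for all $x,y\in V(G)$ with $xy\in A(G)$, all $a_1,\dots,a_k\in L(x)$ and $b_1,\dots,b_k\in L(y)$ with $a_ib_i\in A(H)$ for all $i$, we have $h(x;a_1,\dots,a_k)h(y;b_1,\dots,b_k)\in A(H)$. It is a minority homomorphism if moreover, for every $x\in V(G)$ and all $a,b\in L(x)$ (including $a=b$), $h(x;b,\dots,b,a)=h(x;b,\dots,b,a,b)=\dots=h(x;a,b,\dots,b)=a$, i.e. whenever all coordinates but one equal $b$ and the remaining one equals $a$, the value is $a$. An $L$-homomorphism of $G$ to $H$ is a map $g:V(G)\to V(H)$ with $g(x)\in L(x)$ for all $x$ and $g(x)g(y)\in A(H)$ whenever $xy\in A(G)$. The input of the decision problem is $G$ together with the lists $L$ (and $h$). *)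

theory Defs
  imports "Graph_Theory.Pair_Digraph" "HOL-Computational_Algebra.Polynomial"
begin

section \<open>Lists, homomorphisms and minority homomorphisms\<close>

text \<open>
  Digraphs are arc relations on a vertex set; loops are allowed.  A \<open>k\<close>-tuple is a list of
  length \<open>k\<close>, and the value at \<open>(x; a\<^sub>1, ..., a\<^sub>k)\<close> is \<open>h x [a\<^sub>1, ..., a\<^sub>k]\<close>.  All conditions
  concern only \<open>x \<in> V(G)\<close> and tuples over \<open>L x\<close>, so values of \<open>L\<close>, \<open>h\<close> and \<open>g\<close> elsewhere are
  irrelevant.
\<close>

definition list_assignment ::
  "'a pair_pre_digraph \<Rightarrow> 'b pair_pre_digraph \<Rightarrow> ('a \<Rightarrow> 'b set) \<Rightarrow> bool" where
  "list_assignment G H L \<longleftrightarrow> (\<forall>x \<in> pverts G. L x \<subseteq> pverts H)"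

definition list_homomorphism ::
  "'a pair_pre_digraph \<Rightarrow> 'b pair_pre_digraph \<Rightarrow> ('a \<Rightarrow> 'b set) \<Rightarrow> ('a \<Rightarrow> 'b) \<Rightarrow> bool" where
  "list_homomorphism G H L g \<longleftrightarrow>
     (\<forall>x \<in> pverts G. g x \<in> L x) \<and>
     (\<forall>x y. (x, y) \<in> parcs G \<longrightarrow> (g x, g y) \<in> parcs H)"

definition tuples :: "nat \<Rightarrow> 'b set \<Rightarrow> 'b list set" where
  "tuples k S = {as. length as = k \<and> set as \<subseteq> S}"

definition consistent_homomorphism ::
  "nat \<Rightarrow> 'a pair_pre_digraph \<Rightarrow> 'b pair_pre_digraph \<Rightarrow> ('a \<Rightarrow> 'b set) \<Rightarrow>
   ('a \<Rightarrow> 'b list \<Rightarrow> 'b) \<Rightarrow> bool" where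
  "consistent_homomorphism k G H L h \<longleftrightarrow>
     (\<forall>x \<in> pverts G. \<forall>as \<in> tuples k (L x). h x as \<in> L x) \<and>
     (\<forall>x y. (x, y) \<in> parcs G \<longrightarrow>
        (\<forall>as \<in> tuples k (L x). \<forall>bs \<in> tuples k (L y).
           (\<forall>i < k. (as ! i, bs ! i) \<in> parcs H) \<longrightarrow> (h x as, h y bs) \<in> parcs H))"

definition minority_homomorphism ::
  "nat \<Rightarrow> 'a pair_pre_digraph \<Rightarrow> 'b pair_pre_digraph \<Rightarrow> ('a \<Rightarrow> 'b set) \<Rightarrow>
   ('a \<Rightarrow> 'b list \<Rightarrow> 'b) \<Rightarrow> bool" where
  "minority_homomorphism k G H L h \<longleftrightarrow>
     consistent_homomorphism k G H L h \<and>
     (\<forall>x \<in> pverts G. \<forall>a \<in> L x. \<forall>b \<in> L x. \<forall>i < k. h x ((replicate k b)[i := a]) = a)"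


section \<open>Polynomial time\<close>

text \<open>
  The model of computation is first-order LISP: mutually recursive, call-by-value programs over
  binary trees, where every evaluation step (variable access, \<open>nil\<close>, \<open>cons\<close>, \<open>hd\<close>, \<open>tl\<close>,
  test for \<open>nil\<close>, binding, call) costs one unit.  With values represented by pointers into
  shared memory every step takes constant time for a fixed program, and in particular no step
  compares or copies whole trees.  Hence a run of cost \<open>n\<close> is simulated by a Turing machine in
  time polynomial in \<open>n\<close> and the input size.  Conversely, a Turing machine step is simulated in
  constant cost by keeping each tape as a pair of stacks.  So polynomial time in this model is
  the usual polynomial time; compare the languages over binary trees in N. D. Jones,
  Computability and Complexity from a Programming Perspective (MIT Press, 1997).
\<close>

datatype data = Dnil | Dcons data data

fun dhd :: "data \<Rightarrow> data" where
  "dhd Dnil = Dnil"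
| "dhd (Dcons u v) = u"

fun dtl :: "data \<Rightarrow> data" where
  "dtl Dnil = Dnil"
| "dtl (Dcons u v) = v"

text \<open>
  Variables are positions in the list of currently bound values; \<open>Bind\<close> pushes a value to the
  front, and the body of a called function sees exactly the list of its arguments.
\<close>

datatype expr =
    Var nat
  | NilE
  | ConsE expr expr
  | HdE expr
  | TlE expr
  | IfE expr expr expr
  | Bind expr expr
  | Call nat "expr list"

text \<open>A program is a list of function bodies; \<open>Call f es\<close> calls the function at position \<open>f\<close>.\<close>

type_synonym program = "expr list"

inductive eval :: "program \<Rightarrow> data list \<Rightarrow> expr \<Rightarrow> data \<Rightarrow> nat \<Rightarrow> bool"
  and evals :: "program \<Rightarrow> data list \<Rightarrow> expr list \<Rightarrow> data list \<Rightarrow> nat \<Rightarrow> bool"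
  for P :: program where
  eval_Var: "i < length \<rho> \<Longrightarrow> eval P \<rho> (Var i) (\<rho> ! i) 1"
| eval_Nil: "eval P \<rho> NilE Dnil 1"
| eval_Cons: "eval P \<rho> e u m \<Longrightarrow> eval P \<rho> e' v n \<Longrightarrow> eval P \<rho> (ConsE e e') (Dcons u v) (m + n + 1)"
| eval_Hd: "eval P \<rho> e v n \<Longrightarrow> eval P \<rho> (HdE e) (dhd v) (n + 1)"
| eval_Tl: "eval P \<rho> e v n \<Longrightarrow> eval P \<rho> (TlE e) (dtl v) (n + 1)"
| eval_If_true: "eval P \<rho> b u m \<Longrightarrow> u \<noteq> Dnil \<Longrightarrow> eval P \<rho> e v n \<Longrightarrow>
    eval P \<rho> (IfE b e e') v (m + n + 1)"
| eval_If_false: "eval P \<rho> b Dnil m \<Longrightarrow> eval P \<rho> e' v n \<Longrightarrow> eval P \<rho> (IfE b e e') v (m + n + 1)"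
| eval_Bind: "eval P \<rho> e u m \<Longrightarrow> eval P (u # \<rho>) e' v n \<Longrightarrow> eval P \<rho> (Bind e e') v (m + n + 1)"
| eval_Call: "evals P \<rho> es us m \<Longrightarrow> f < length P \<Longrightarrow> eval P us (P ! f) v n \<Longrightarrow>
    eval P \<rho> (Call f es) v (m + n + 1)"
| evals_Nil: "evals P \<rho> [] [] 0"
| evals_Cons: "eval P \<rho> e v m \<Longrightarrow> evals P \<rho> es vs n \<Longrightarrow> evals P \<rho> (e # es) (v # vs) (m + n)"

inductive_cases eval_VarE: "eval P \<rho> (Var i) v n"
inductive_cases eval_NilE: "eval P \<rho> NilE v n"
inductive_cases eval_ConsE: "eval P \<rho> (ConsE e e') v n"
inductive_cases eval_HdE: "eval P \<rho> (HdE e) v n"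
inductive_cases eval_TlE: "eval P \<rho> (TlE e) v n"
inductive_cases eval_IfE: "eval P \<rho> (IfE b e e') v n"
inductive_cases eval_BindE: "eval P \<rho> (Bind e e') v n"
inductive_cases eval_CallE: "eval P \<rho> (Call f es) v n"
inductive_cases evals_NilE: "evals P \<rho> [] vs n"
inductive_cases evals_ConsE: "evals P \<rho> (e # es) vs n"

text \<open>Evaluation is deterministic, so result and cost are functions of program and input.\<close>

lemma eval_deterministic:
  shows "eval P \<rho> e v n \<Longrightarrow> eval P \<rho> e v' n' \<Longrightarrow> v = v' \<and> n = n'"
    and "evals P \<rho> es vs n \<Longrightarrow> evals P \<rho> es vs' n' \<Longrightarrow> vs = vs' \<and> n = n'"
proof (induction arbitrary: v' n' and vs' n' rule: eval_evals.inducts)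
  case eval_Var then show ?case by (auto elim: eval_VarE)
next
  case eval_Nil then show ?case by (auto elim: eval_NilE)
next
  case eval_Cons
  from eval_Cons.prems show ?case by (rule eval_ConsE) (use eval_Cons in \<open>metis Suc_eq_plus1\<close>)
next
  case eval_Hd
  from eval_Hd.prems show ?case by (rule eval_HdE) (use eval_Hd in \<open>metis Suc_eq_plus1\<close>)
next
  case eval_Tl
  from eval_Tl.prems show ?case by (rule eval_TlE) (use eval_Tl in \<open>metis Suc_eq_plus1\<close>)
next
  case eval_If_true
  from eval_If_true.prems show ?case by (rule eval_IfE) (use eval_If_true in \<open>metis Suc_eq_plus1\<close>)+
next
  case eval_If_false
  from eval_If_false.prems show ?case by (rule eval_IfE) (use eval_If_false in \<open>metis Suc_eq_plus1\<close>)+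
next
  case eval_Bind
  from eval_Bind.prems show ?case by (rule eval_BindE) (use eval_Bind in \<open>metis Suc_eq_plus1\<close>)
next
  case eval_Call
  from eval_Call.prems show ?case by (rule eval_CallE) (use eval_Call in \<open>metis Suc_eq_plus1\<close>)
next
  case evals_Nil then show ?case by (auto elim: evals_NilE)
next
  case evals_Cons
  from evals_Cons.prems show ?case by (rule evals_ConsE) (use evals_Cons in \<open>metis Suc_eq_plus1\<close>)
qed

text \<open>
  The program runs its function at position 0 on the input and answers yes by a value other
  than \<open>nil\<close>.
\<close>

definition runs :: "program \<Rightarrow> data \<Rightarrow> data \<Rightarrow> nat \<Rightarrow> bool" where
  "runs P inp out n \<longleftrightarrow> eval P [inp] (Call 0 [Var 0]) out n"

text \<open>
  Instances satisfying \<open>promise\<close> are to be decided; \<open>encodes i t\<close> says that \<open>t\<close> is an encoding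
  of the instance \<open>i\<close>, and \<open>yes i\<close> that \<open>i\<close> is a positive instance.  The size of a tree is
  the number of its \<open>cons\<close> nodes.
\<close>

definition poly_time_decidable ::
  "('i \<Rightarrow> bool) \<Rightarrow> ('i \<Rightarrow> data \<Rightarrow> bool) \<Rightarrow> ('i \<Rightarrow> bool) \<Rightarrow> bool" where
  "poly_time_decidable promise encodes yes \<longleftrightarrow>
     (\<exists>(P :: program) (q :: nat poly). \<forall>i t. promise i \<longrightarrow> encodes i t \<longrightarrow>
        (\<exists>out n. runs P t out n \<and> n \<le> poly q (size t) \<and> (out \<noteq> Dnil \<longleftrightarrow> yes i)))"


section \<open>Encoding of instances\<close>

text \<open>Binary notation, least significant digit first.\<close>

fun nat_code :: "nat \<Rightarrow> data" where
  "nat_code n =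
     (if n = 0 then Dnil
      else Dcons (if odd n then Dcons Dnil Dnil else Dnil) (nat_code (n div 2)))"

declare nat_code.simps [simp del]

definition list_code :: "('a \<Rightarrow> data) \<Rightarrow> 'a list \<Rightarrow> data" where
  "list_code c xs = foldr (\<lambda>x t. Dcons (c x) t) xs Dnil"

definition pair_code :: "('a \<Rightarrow> data) \<Rightarrow> ('b \<Rightarrow> data) \<Rightarrow> 'a \<times> 'b \<Rightarrow> data" where
  "pair_code c d p = Dcons (c (fst p)) (d (snd p))"

text \<open>A finite set is given by listing its elements without repetition in an arbitrary order.\<close>

definition set_encoding :: "('a \<Rightarrow> data) \<Rightarrow> 'a set \<Rightarrow> data \<Rightarrow> bool" where
  "set_encoding c S t \<longleftrightarrow> (\<exists>xs. distinct xs \<and> set xs = S \<and> t = list_code c xs)"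

text \<open>
  The input consists of the vertices of \<open>G\<close>, the arcs of \<open>G\<close>, the lists as the set of pairs
  \<open>(x, a)\<close> with \<open>a \<in> L x\<close>, and the value table of \<open>h\<close>.
\<close>

definition instance_encoding ::
  "nat \<Rightarrow> nat pair_pre_digraph \<times> (nat \<Rightarrow> nat set) \<times> (nat \<Rightarrow> nat list \<Rightarrow> nat) \<Rightarrow> data \<Rightarrow> bool" where
  "instance_encoding k = (\<lambda>(G, L, h) t. \<exists>tV tA tL th.
     t = Dcons tV (Dcons tA (Dcons tL th)) \<and>
     set_encoding nat_code (pverts G) tV \<and>
     set_encoding (pair_code nat_code nat_code) (parcs G) tA \<and>
     set_encoding (pair_code nat_code nat_code) (SIGMA x : pverts G. L x) tL \<and>
     set_encoding (pair_code nat_code (pair_code (list_code nat_code) nat_code))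
       {(x, as, h x as) | x as. x \<in> pverts G \<and> as \<in> tuples k (L x)} th)"

end

theory Submission
  imports Defs "HOL-Library.Sublist"
begin

text \<open>
  For each vertex \<open>x\<close>, the operation \<open>h(x; a, b, ..., b, c)\<close> is a Maltsev operation on \<open>L(x)\<close>, so the
  problem is a multi-sorted Maltsev constraint problem.  A relation \<open>R\<close> preserved by such an operation has
  a compact representation with respect to an ordering of the variables: for each variable \<open>z\<close>
  and each pair of values at \<open>z\<close> taken by two members of \<open>R\<close> that agree on all earlier variables,
  store one such pair of members.  If \<open>(w, w')\<close> is stored for \<open>z\<close> and \<open>t \<in> R\<close> has the same value
  at \<open>z\<close> as \<open>w\<close>, then \<open>m(t, w, w')\<close> agrees with \<open>t\<close> on the earlier variables and has the value of
  \<open>w'\<close> at \<open>z\<close>.  With this exchange step two adjacent variables can be transposed, so every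
  variable can be moved to the front, and a constraint on the first two variables is imposed by
  filtering.  Starting from the product of the lists and imposing the arcs of \<open>G\<close> one by one,
  there is an \<open>L\<close>-homomorphism if and only if no stored list of pairs ends up empty.

  Polynomial time is established without writing down a program: the functions computable with
  polynomial cost and polynomial output size are closed under the list operations from which the
  algorithm is composed.
\<close>

section \<open>Feasible functions\<close>

text \<open>Injectivity of \<open>enc\<close> reduces equality of values to equality of trees, which
  is what lets \<open>feasible_eq\<close> run one and the same comparison program at every
  type.\<close>

class code =
  fixes enc :: "'a \<Rightarrow> data"
  assumes enc_eqD: "enc x = enc y \<Longrightarrow> x = y"

lemma enc_eq_iff [simp]: "enc x = enc y \<longleftrightarrow> x = y"
  using enc_eqD by blast

instantiation bool :: code
begin
text \<open>\<open>False\<close> becomes \<open>Dnil\<close>, so a computed Boolean can serve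
  directly as the condition of \<open>IfE\<close> and as the final answer of a run.\<close>

definition "enc b = (if b then Dcons Dnil Dnil else Dnil)"
instance by standard (auto simp: enc_bool_def split: if_splits)
end

lemma nat_code_inj: "nat_code m = nat_code n \<Longrightarrow> m = n"
proof (induction m arbitrary: n rule: less_induct)
  case (less m)
  show ?case
  proof (cases "m = 0 \<or> n = 0")
    case True
    then show ?thesis
      using less.prems by (simp add: nat_code.simps[of m] nat_code.simps[of n] split: if_splits)
  next
    case False
    then have "nat_code (m div 2) = nat_code (n div 2)" "odd m \<longleftrightarrow> odd n"
      using less.prems by (auto simp: nat_code.simps[of m] nat_code.simps[of n] split: if_splits)
    with less.IH[of "m div 2" "n div 2"] False have "m div 2 = n div 2" "m mod 2 = n mod 2"
      by (simp_all add: mod2_eq_if)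
    then show ?thesis by (metis div_mult_mod_eq)
  qed
qed

instantiation nat :: code
begin
definition "enc (n :: nat) = nat_code n"
instance by standard (auto simp: enc_nat_def dest: nat_code_inj)
end

instantiation prod :: (code, code) code
begin
definition "enc p = pair_code enc enc p"
instance by standard (auto simp: enc_prod_def pair_code_def prod_eq_iff)
end

instantiation list :: (code) code
begin
definition "enc xs = list_code enc xs"
instance
proof
  fix xs ys :: "'a list"
  show "enc xs = enc ys \<Longrightarrow> xs = ys"
    unfolding enc_list_def
  proof (induction xs arbitrary: ys)
    case Nil
    then show ?case by (cases ys) (auto simp: list_code_def)
  next
    case (Cons x xs)
    then show ?case by (cases ys) (auto simp: list_code_def)
  qed
qed
end

lemma enc_simps [simp]:
  "enc [] = Dnil" "enc (x # xs) = Dcons (enc x) (enc xs)" "enc (a, b) = Dcons (enc a) (enc b)"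
  "enc True = Dcons Dnil Dnil" "enc False = Dnil"
  by (simp_all add: enc_list_def list_code_def enc_prod_def pair_code_def enc_bool_def)

lemma size_enc_bool: "size (enc (b :: bool)) \<le> 1"
  by (cases b) simp_all

lemma size_enc_list: "size (enc xs) = (\<Sum>x\<leftarrow>xs. size (enc x) + 1)"
  by (induction xs) simp_all

lemma size_enc_append [simp]: "size (enc (xs @ ys)) = size (enc xs) + size (enc ys)"
  by (simp add: size_enc_list)

lemma size_enc_member: "x \<in> set xs \<Longrightarrow> size (enc x) < size (enc xs)"
  by (induction xs) auto

lemma length_le_size_enc: "length xs \<le> size (enc xs)"
  by (induction xs) simp_all

lemma size_enc_list_le:
  "(\<And>x. x \<in> set xs \<Longrightarrow> size (enc x) \<le> b) \<Longrightarrow> size (enc xs) \<le> length xs * (b + 1)"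
proof (induction xs)
  case (Cons x xs)
  from Cons.prems[of x] Cons.IH[OF Cons.prems] show ?case by simp
qed simp

section \<open>Polynomial bounds in the size of the environment\<close>

definition env_size :: "('s \<Rightarrow> data) list \<Rightarrow> 's \<Rightarrow> nat" where
  "env_size E s = 2 + (\<Sum>f\<leftarrow>E. size (f s))"

text \<open>A single power replaces a general polynomial. The summand 2 in \<open>env_size\<close>
  keeps the base at least 2, so constants, factors and sums are absorbed by raising the
  exponent.\<close>

definition poly_bounded :: "('s \<Rightarrow> data) list \<Rightarrow> ('s \<Rightarrow> nat) \<Rightarrow> bool" where
  "poly_bounded E c \<longleftrightarrow> (\<exists>d. \<forall>s. c s \<le> env_size E s ^ d)"

lemma env_size_ge_2: "2 \<le> env_size E s"
  by (simp add: env_size_def)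

named_theorems bounds

lemma poly_bounded_mono: "poly_bounded E c \<Longrightarrow> (\<And>s. c' s \<le> c s) \<Longrightarrow> poly_bounded E c'"
  unfolding poly_bounded_def by (meson order_trans)

lemma poly_bounded_const [bounds]: "poly_bounded E (\<lambda>_. c)"
  unfolding poly_bounded_def
proof (intro exI allI)
  fix s
  have "c \<le> 2 ^ c" by (simp add: less_imp_le)
  also have "\<dots> \<le> env_size E s ^ c" by (rule power_mono[OF env_size_ge_2]) simp
  finally show "c \<le> env_size E s ^ c" .
qed

lemma poly_bounded_mult [bounds]:
  assumes "poly_bounded E a" "poly_bounded E b"
  shows "poly_bounded E (\<lambda>s. a s * b s)"
proof -
  from assms obtain d d' where "\<And>s. a s \<le> env_size E s ^ d" "\<And>s. b s \<le> env_size E s ^ d'"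
    unfolding poly_bounded_def by blast
  then have "a s * b s \<le> env_size E s ^ (d + d')" for s
    unfolding power_add by (intro mult_mono) simp_all
  then show ?thesis unfolding poly_bounded_def by blast
qed

lemma poly_bounded_add [bounds]:
  assumes "poly_bounded E a" "poly_bounded E b"
  shows "poly_bounded E (\<lambda>s. a s + b s)"
proof -
  from assms obtain d d' where d: "\<And>s. a s \<le> env_size E s ^ d" "\<And>s. b s \<le> env_size E s ^ d'"
    unfolding poly_bounded_def by blast
  have *: "poly_bounded E (\<lambda>s. 2 * env_size E s ^ max d d')"
    by (rule poly_bounded_mult[OF poly_bounded_const]) (auto simp: poly_bounded_def)
  have "a s + b s \<le> 2 * env_size E s ^ max d d'" for s
  proof -
    have "1 \<le> env_size E s" using env_size_ge_2[of E s] by simp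
    then have "env_size E s ^ d \<le> env_size E s ^ max d d'" "env_size E s ^ d' \<le> env_size E s ^ max d d'"
      by (simp_all add: power_increasing)
    then show ?thesis
      using d(1)[of s] d(2)[of s] by linarith
  qed
  with * show ?thesis by (rule poly_bounded_mono)
qed

lemma poly_bounded_Suc [bounds]: "poly_bounded E a \<Longrightarrow> poly_bounded E (\<lambda>s. Suc (a s))"
  using poly_bounded_add[OF _ poly_bounded_const[of E 1]] by simp

lemma poly_bounded_power [bounds]: "poly_bounded E a \<Longrightarrow> poly_bounded E (\<lambda>s. a s ^ d)"
proof (induction d)
  case 0
  show ?case using poly_bounded_const[of E 1] by simp
next
  case (Suc d)
  with poly_bounded_mult[of E a] show ?case by simp
qed

lemma poly_bounded_env_size [bounds]: "poly_bounded E (env_size E)"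
  unfolding poly_bounded_def by (rule exI[of _ 1]) simp

lemma poly_bounded_env:
  assumes "f \<in> set E"
  shows "poly_bounded E (\<lambda>s. size (f s))"
proof (rule poly_bounded_mono[OF poly_bounded_env_size])
  show "size (f s) \<le> env_size E s" for s
    using member_le_sum_list[of "size (f s)" "map (\<lambda>f. size (f s)) E"] assms
    by (simp add: env_size_def)
qed

section \<open>Evaluation with upper bounds on the cost\<close>

definition eval_within :: "program \<Rightarrow> data list \<Rightarrow> expr \<Rightarrow> data \<Rightarrow> nat \<Rightarrow> bool" where
  "eval_within P \<rho> e v c \<longleftrightarrow> (\<exists>n\<le>c. eval P \<rho> e v n)"

definition evals_within :: "program \<Rightarrow> data list \<Rightarrow> expr list \<Rightarrow> data list \<Rightarrow> nat \<Rightarrow> bool" where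
  "evals_within P \<rho> es vs c \<longleftrightarrow> (\<exists>n\<le>c. evals P \<rho> es vs n)"

text \<open>Calls refer to absolute positions, so functions added at the end leave every existing
  call with its old target.\<close>

lemma eval_append:
  shows "eval P \<rho> e v n \<Longrightarrow> eval (P @ Q) \<rho> e v n"
    and "evals P \<rho> es vs n \<Longrightarrow> evals (P @ Q) \<rho> es vs n"
proof (induction rule: eval_evals.inducts)
  case (eval_Call \<rho> es us m f v n)
  then show ?case by (intro eval_evals.eval_Call) (auto simp: nth_append)
qed (blast intro: eval_evals.intros)+

lemma eval_within_append: "eval_within P \<rho> e v c \<Longrightarrow> eval_within (P @ Q) \<rho> e v c"
  unfolding eval_within_def by (blast intro: eval_append)

lemma eval_within_mono: "eval_within P \<rho> e v c \<Longrightarrow> c \<le> c' \<Longrightarrow> eval_within P \<rho> e v c'"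
  unfolding eval_within_def by (meson order_trans)

lemma eval_within_Var: "i < length \<rho> \<Longrightarrow> v = \<rho> ! i \<Longrightarrow> eval_within P \<rho> (Var i) v (Suc 0)"
  unfolding eval_within_def using eval_Var by fastforce

lemma eval_within_NilE: "eval_within P \<rho> NilE Dnil (Suc 0)"
  unfolding eval_within_def using eval_Nil by fastforce

lemma eval_within_ConsE:
  "eval_within P \<rho> e u m \<Longrightarrow> eval_within P \<rho> e' v n \<Longrightarrow>
   eval_within P \<rho> (ConsE e e') (Dcons u v) (Suc (m + n))"
  unfolding eval_within_def by (metis eval_Cons Suc_eq_plus1 Suc_le_mono add_mono)

lemma eval_within_HdE: "eval_within P \<rho> e v n \<Longrightarrow> u = dhd v \<Longrightarrow> eval_within P \<rho> (HdE e) u (Suc n)"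
  unfolding eval_within_def by (metis eval_Hd Suc_eq_plus1 Suc_le_mono)

lemma eval_within_TlE: "eval_within P \<rho> e v n \<Longrightarrow> u = dtl v \<Longrightarrow> eval_within P \<rho> (TlE e) u (Suc n)"
  unfolding eval_within_def by (metis eval_Tl Suc_eq_plus1 Suc_le_mono)

lemma eval_within_IfE:
  assumes "eval_within P \<rho> b u m"
    and "u \<noteq> Dnil \<Longrightarrow> eval_within P \<rho> e v n"
    and "u = Dnil \<Longrightarrow> eval_within P \<rho> e' v n"
  shows "eval_within P \<rho> (IfE b e e') v (Suc (m + n))"
proof (cases "u = Dnil")
  case True
  with assms show ?thesis unfolding eval_within_def by (metis eval_If_false Suc_eq_plus1 Suc_le_mono add_mono)
next
  case False
  with assms show ?thesis unfolding eval_within_def by (metis eval_If_true Suc_eq_plus1 Suc_le_mono add_mono)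
qed

lemma eval_within_Call:
  assumes "evals_within P \<rho> es us m" "f < length P" "eval_within P us (P ! f) v n"
  shows "eval_within P \<rho> (Call f es) v (Suc (m + n))"
  using assms unfolding eval_within_def evals_within_def by (metis eval_Call Suc_eq_plus1 Suc_le_mono add_mono)

lemma evals_within_Nil: "evals_within P \<rho> [] [] 0"
  unfolding evals_within_def using evals_Nil by blast

lemma evals_within_Cons:
  "eval_within P \<rho> e v m \<Longrightarrow> evals_within P \<rho> es vs n \<Longrightarrow> evals_within P \<rho> (e # es) (v # vs) (m + n)"
  unfolding eval_within_def evals_within_def by (meson evals_Cons add_mono)

text \<open>A called function sees only its arguments. Passing the variables behind a prefix
  \<open>\<sigma>\<close> is how a call hands on the surrounding environment.\<close>

lemma evals_within_Vars:
  assumes "length \<sigma> = a"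
  shows "evals_within P (\<sigma> @ \<rho>) (map Var [a..<a + length \<rho>]) \<rho> (length \<rho>)"
  using assms
proof (induction \<rho> arbitrary: \<sigma> a)
  case Nil
  then show ?case by (simp add: evals_within_Nil)
next
  case (Cons v \<rho>)
  have "evals_within P ((\<sigma> @ [v]) @ \<rho>) (map Var [Suc a..<Suc a + length \<rho>]) \<rho> (length \<rho>)"
    by (rule Cons.IH) (simp add: Cons.prems)
  moreover have "eval_within P (\<sigma> @ v # \<rho>) (Var a) v (Suc 0)"
    by (rule eval_within_Var) (use Cons.prems in auto)
  ultimately have "evals_within P (\<sigma> @ v # \<rho>) (Var a # map Var [Suc a..<Suc a + length \<rho>]) (v # \<rho>) (Suc 0 + length \<rho>)"
    by (intro evals_within_Cons) simp_all
  moreover have "[a..<a + length (v # \<rho>)] = a # [Suc a..<Suc a + length \<rho>]"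
    by (subst upt_conv_Cons) simp_all
  ultimately show ?case by simp
qed

text \<open>
  The situation \<open>s\<close> determines both the environment \<open>E\<close> and the value \<open>f s\<close>.  Quantifying over
  the length \<open>l\<close> of a program prefix lets subprograms be concatenated without renumbering calls.
\<close>

definition computes ::
  "('s \<Rightarrow> data) list \<Rightarrow> nat \<Rightarrow> program \<Rightarrow> expr \<Rightarrow> ('s \<Rightarrow> 'a :: code) \<Rightarrow> ('s \<Rightarrow> nat) \<Rightarrow> bool" where
  "computes E l Q e f c \<longleftrightarrow> (\<forall>P R s. length P = l \<longrightarrow>
     eval_within (P @ Q @ R) (map (\<lambda>f. f s) E) e (enc (f s)) (c s))"

lemma computesI:
  assumes "\<And>P s. length P = l \<Longrightarrow> eval_within (P @ Q) (map (\<lambda>f. f s) E) e (enc (f s)) (c s)"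
  shows "computes E l Q e f c"
  unfolding computes_def using eval_within_append[OF assms] by simp

lemma computesD:
  "computes E l Q e f c \<Longrightarrow> length P = l \<Longrightarrow>
   eval_within (P @ Q @ R) (map (\<lambda>f. f s) E) e (enc (f s)) (c s)"
  unfolding computes_def by blast

text \<open>The size of the value is bounded separately from the cost: with \<open>Bind\<close> and
  \<open>ConsE\<close> a tree can be doubled at constant cost, so few steps may build an
  exponentially large value.\<close>

definition feasible :: "('s \<Rightarrow> data) list \<Rightarrow> ('s \<Rightarrow> 'a :: code) \<Rightarrow> bool" where
  "feasible E f \<longleftrightarrow> poly_bounded E (\<lambda>s. size (enc (f s))) \<and>
     (\<forall>l. \<exists>Q e c. poly_bounded E c \<and> computes E l Q e f c)"

lemma feasibleI:
  assumes "poly_bounded E (\<lambda>s. size (enc (f s)))"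
    and "\<And>l. \<exists>Q e c. poly_bounded E c \<and> computes E l Q e f c"
  shows "feasible E f"
  using assms unfolding feasible_def by blast

lemma feasibleE:
  assumes "feasible E f"
  obtains Q e c where "poly_bounded E c" "computes E l Q e f c"
  using assms unfolding feasible_def by blast

lemma feasible_bounded [bounds]: "feasible E f \<Longrightarrow> poly_bounded E (\<lambda>s. size (enc (f s)))"
  unfolding feasible_def by blast

lemma feasible_length_bounded [bounds]: "feasible E xs \<Longrightarrow> poly_bounded E (\<lambda>s. length (xs s))"
  by (rule poly_bounded_mono[OF feasible_bounded]) (auto simp: length_le_size_enc)

named_theorems feas

section \<open>Closure under constructors, projections, conditionals and equality tests\<close>

lemma feasible_map1:
  assumes f: "feasible E f"
    and bd: "poly_bounded E (\<lambda>s. size (enc (g s)))"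
    and ev: "\<And>P \<rho> s e n. eval_within P \<rho> e (enc (f s)) n \<Longrightarrow> eval_within P \<rho> (F e) (enc (g s)) (n + c)"
  shows "feasible E g"
proof (rule feasibleI[OF bd])
  fix l
  obtain Q e c' where Q: "poly_bounded E c'" "computes E l Q e f c'"
    using feasibleE[OF f] by blast
  have "poly_bounded E (\<lambda>s. c' s + c)" by (intro bounds Q)
  moreover have "computes E l Q (F e) g (\<lambda>s. c' s + c)"
    using ev[OF computesD[OF Q(2), of _ "[]"]] by (intro computesI) simp
  ultimately show "\<exists>Q e c. poly_bounded E c \<and> computes E l Q e g c" by blast
qed

lemma feasible_map2:
  assumes f: "feasible E f1" "feasible E f2"
    and bd: "poly_bounded E (\<lambda>s. size (enc (g s)))"
    and ev: "\<And>P \<rho> s e1 e2 n1 n2. eval_within P \<rho> e1 (enc (f1 s)) n1 \<Longrightarrow> eval_within P \<rho> e2 (enc (f2 s)) n2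
      \<Longrightarrow> eval_within P \<rho> (F e1 e2) (enc (g s)) (n1 + n2 + c)"
  shows "feasible E g"
proof (rule feasibleI[OF bd])
  fix l
  obtain Q1 e1 c1 where Q1: "poly_bounded E c1" "computes E l Q1 e1 f1 c1"
    using feasibleE[OF f(1)] by blast
  \<comment> \<open>The functions for the second argument are placed behind those for the first;
    this is where an arbitrary prefix length in \<open>feasible\<close> is used.\<close>
  obtain Q2 e2 c2 where Q2: "poly_bounded E c2" "computes E (l + length Q1) Q2 e2 f2 c2"
    using feasibleE[OF f(2)] by blast
  have "poly_bounded E (\<lambda>s. c1 s + c2 s + c)" by (intro bounds Q1 Q2)
  moreover have "computes E l (Q1 @ Q2) (F e1 e2) g (\<lambda>s. c1 s + c2 s + c)"
  proof (intro computesI ev)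
    fix P :: program and s assume P: "length P = l"
    then show "eval_within (P @ Q1 @ Q2) (map (\<lambda>f. f s) E) e1 (enc (f1 s)) (c1 s)"
      by (rule computesD[OF Q1(2)])
    show "eval_within (P @ Q1 @ Q2) (map (\<lambda>f. f s) E) e2 (enc (f2 s)) (c2 s)"
      using computesD[OF Q2(2), of "P @ Q1" "[]"] P by simp
  qed
  ultimately show "\<exists>Q e c. poly_bounded E c \<and> computes E l Q e g c" by blast
qed

primrec quote :: "data \<Rightarrow> expr" where
  "quote Dnil = NilE"
| "quote (Dcons u v) = ConsE (quote u) (quote v)"

lemma eval_within_quote: "eval_within P \<rho> (quote v) v (2 * size v + 1)"
proof (induction v)
  case Dnil
  then show ?case by (simp add: eval_within_NilE)
next
  case (Dcons u v)
  from eval_within_ConsE[OF this] show ?case by (simp add: algebra_simps)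
qed

text \<open>Constants are quoted in the program text. In this way the vertices and arcs of the fixed
  digraph \<open>H\<close> enter the algorithm.\<close>

lemma feasible_const [feas]: "feasible E (\<lambda>_. a)"
proof (rule feasibleI)
  have "computes E l [] (quote (enc a)) (\<lambda>_. a) (\<lambda>_. 2 * size (enc a) + 1)" for l
    by (intro computesI eval_within_quote)
  then show "\<exists>Q e c. poly_bounded E c \<and> computes E l Q e (\<lambda>_. a) c" for l
    using poly_bounded_const by blast
qed (rule poly_bounded_const)

lemma feasible_env:
  assumes "(\<lambda>s. enc (f s)) \<in> set E"
  shows "feasible E f"
proof (rule feasibleI)
  from assms obtain i where i: "i < length E" "E ! i = (\<lambda>s. enc (f s))"
    by (auto simp: in_set_conv_nth)
  then have "computes E l [] (Var i) f (\<lambda>_. Suc 0)" for l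
    by (intro computesI eval_within_Var) auto
  then show "\<exists>Q e c. poly_bounded E c \<and> computes E l Q e f c" for l
    using poly_bounded_const by blast
qed (use poly_bounded_env[OF assms] in simp)

lemma feasible_Pair [feas]: "feasible E a \<Longrightarrow> feasible E b \<Longrightarrow> feasible E (\<lambda>s. (a s, b s))"
  by (rule feasible_map2[where F = ConsE and c = 1 and ?f1.0 = a and ?f2.0 = b]) (auto intro: eval_within_ConsE intro!: poly_bounded_Suc[OF poly_bounded_add] feasible_bounded)

lemma feasible_Cons [feas]: "feasible E a \<Longrightarrow> feasible E b \<Longrightarrow> feasible E (\<lambda>s. a s # b s)"
  by (rule feasible_map2[where F = ConsE and c = 1 and ?f1.0 = a and ?f2.0 = b]) (auto intro: eval_within_ConsE intro!: poly_bounded_Suc[OF poly_bounded_add] feasible_bounded)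

lemma feasible_fst [feas]:
  assumes "feasible E a"
  shows "feasible E (\<lambda>s. fst (a s))"
proof (rule feasible_map1[OF assms, where F = HdE and c = 1])
  show "poly_bounded E (\<lambda>s. size (enc (fst (a s))))"
    by (rule poly_bounded_mono[OF feasible_bounded[OF assms]]) (simp add: enc_prod_def pair_code_def)
qed (auto intro!: eval_within_HdE simp: enc_prod_def pair_code_def)

lemma feasible_snd [feas]:
  assumes "feasible E a"
  shows "feasible E (\<lambda>s. snd (a s))"
proof (rule feasible_map1[OF assms, where F = TlE and c = 1])
  show "poly_bounded E (\<lambda>s. size (enc (snd (a s))))"
    by (rule poly_bounded_mono[OF feasible_bounded[OF assms]]) (simp add: enc_prod_def pair_code_def)
qed (auto intro!: eval_within_TlE simp: enc_prod_def pair_code_def)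

lemma feasible_case_prod [feas]:
  "feasible E (\<lambda>s. g s (fst (a s)) (snd (a s))) \<Longrightarrow> feasible E (\<lambda>s. case a s of (x, y) \<Rightarrow> g s x y)"
  by (simp add: case_prod_beta)

lemma enc_tl: "enc (tl xs) = dtl (enc xs)"
  by (cases xs) simp_all

lemma feasible_tl [feas]:
  assumes "feasible E a"
  shows "feasible E (\<lambda>s. tl (a s))"
proof (rule feasible_map1[OF assms, where F = TlE and c = 1])
  have "size (dtl v) \<le> size v" for v by (cases v) simp_all
  then show "poly_bounded E (\<lambda>s. size (enc (tl (a s))))"
    by (intro poly_bounded_mono[OF feasible_bounded[OF assms]]) (simp add: enc_tl)
qed (auto intro!: eval_within_TlE simp: enc_tl)

lemma feasible_if [feas]:
  assumes "feasible E b" "feasible E f1" "feasible E f2"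
  shows "feasible E (\<lambda>s. if b s then f1 s else f2 s)"
proof (rule feasibleI)
  show "poly_bounded E (\<lambda>s. size (enc (if b s then f1 s else f2 s)))"
    by (rule poly_bounded_mono[OF poly_bounded_add[OF assms(2,3)[THEN feasible_bounded]]]) simp
  fix l
  obtain Q e c where Q: "poly_bounded E c" "computes E l Q e b c"
    using feasibleE[OF assms(1)] by blast
  obtain Q1 e1 c1 where Q1: "poly_bounded E c1" "computes E (l + length Q) Q1 e1 f1 c1"
    using feasibleE[OF assms(2)] by blast
  obtain Q2 e2 c2 where Q2: "poly_bounded E c2" "computes E (l + length Q + length Q1) Q2 e2 f2 c2"
    using feasibleE[OF assms(3)] by blast
  have "poly_bounded E (\<lambda>s. Suc (c s + (c1 s + c2 s)))" by (intro bounds Q Q1 Q2)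
  moreover have "computes E l (Q @ Q1 @ Q2) (IfE e e1 e2) (\<lambda>s. if b s then f1 s else f2 s)
      (\<lambda>s. Suc (c s + (c1 s + c2 s)))"
  proof (intro computesI eval_within_IfE)
    fix P :: program and s assume P: "length P = l"
    let ?P = "P @ Q @ Q1 @ Q2" and ?\<rho> = "map (\<lambda>f. f s) E"
    from P show "eval_within ?P ?\<rho> e (enc (b s)) (c s)"
      by (rule computesD[OF Q(2)])
    show "eval_within ?P ?\<rho> e1 (enc (if b s then f1 s else f2 s)) (c1 s + c2 s)"
      if "enc (b s) \<noteq> Dnil"
      using that computesD[OF Q1(2), of "P @ Q" Q2 s] P
      by (cases "b s") (auto intro: eval_within_mono)
    show "eval_within ?P ?\<rho> e2 (enc (if b s then f1 s else f2 s)) (c1 s + c2 s)"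
      if "enc (b s) = Dnil"
      using that computesD[OF Q2(2), of "P @ Q @ Q1" "[]" s] P
      by (cases "b s") (auto intro: eval_within_mono)
  qed
  ultimately show "\<exists>Q e c. poly_bounded E c \<and> computes E l Q e (\<lambda>s. if b s then f1 s else f2 s) c"
    by blast
qed

lemma feasible_conj [feas]:
  assumes "feasible E a" "feasible E b"
  shows "feasible E (\<lambda>s. a s \<and> b s)"
proof -
  have "feasible E (\<lambda>s. if a s then b s else False)" by (intro feas assms)
  moreover have "(\<lambda>s. if a s then b s else False) = (\<lambda>s. a s \<and> b s)" by auto
  ultimately show ?thesis by simp
qed

lemma feasible_disj [feas]:
  assumes "feasible E a" "feasible E b"
  shows "feasible E (\<lambda>s. a s \<or> b s)"
proof -
  have "feasible E (\<lambda>s. if a s then True else b s)" by (intro feas assms)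
  moreover have "(\<lambda>s. if a s then True else b s) = (\<lambda>s. a s \<or> b s)" by auto
  ultimately show ?thesis by simp
qed

text \<open>The parameter \<open>f\<close> is the position of this very function, so the calls are
  recursive and compare heads before tails.\<close>

definition equality_body :: "nat \<Rightarrow> expr" where
  "equality_body f =
     IfE (Var 0)
       (IfE (Var 1)
         (IfE (Call f [HdE (Var 0), HdE (Var 1)]) (Call f [TlE (Var 0), TlE (Var 1)]) NilE)
         NilE)
       (IfE (Var 1) NilE (ConsE NilE NilE))"

text \<open>Recursion happens only where both trees have a node, so the cost is linear in the first
  tree alone. The coefficients 40 and 10 are generous enough for the constant overhead of each node
  and each call.\<close>

lemma eval_within_equality_body:
  assumes "f < length P" "P ! f = equality_body f"
  shows "eval_within P [u, v] (equality_body f) (enc (u = v)) (40 * size u + 10)"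
proof (induction u arbitrary: v)
  case Dnil
  have "eval_within P [Dnil, v] (IfE (Var 1) NilE (ConsE NilE NilE)) (enc (Dnil = v)) (Suc (Suc 0 + 3))"
  proof (rule eval_within_IfE)
    show "eval_within P [Dnil, v] (Var 1) v (Suc 0)" by (rule eval_within_Var) simp_all
    show "eval_within P [Dnil, v] NilE (enc (Dnil = v)) 3" if "v \<noteq> Dnil"
      using that eval_within_mono[OF eval_within_NilE] by simp
    show "eval_within P [Dnil, v] (ConsE NilE NilE) (enc (Dnil = v)) 3" if "v = Dnil"
      using that eval_within_ConsE[OF eval_within_NilE eval_within_NilE] by (simp add: numeral_3_eq_3)
  qed
  then have "eval_within P [Dnil, v] (equality_body f) (enc (Dnil = v)) (Suc (Suc 0 + Suc (Suc 0 + 3)))"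
    unfolding equality_body_def
    by (intro eval_within_IfE[where b = "Var 0" and u = Dnil] eval_within_Var) simp_all
  then show ?case by (rule eval_within_mono) simp
next
  case (Dcons u1 u2)
  let ?\<rho> = "[Dcons u1 u2, v]"
  have var: "eval_within P ?\<rho> (Var 0) (Dcons u1 u2) (Suc 0)" "eval_within P ?\<rho> (Var 1) v (Suc 0)"
    by (auto intro!: eval_within_Var)
  have call: "eval_within P ?\<rho> (Call f [e, e']) (enc (a = b)) (40 * size a + 15)"
    if "eval_within P ?\<rho> e a 2" "eval_within P ?\<rho> e' b 2"
      "eval_within P [a, b] (equality_body f) (enc (a = b)) (40 * size a + 10)" for e e' a b
  proof -
    have "evals_within P ?\<rho> [e, e'] [a, b] (2 + (2 + 0))"
      by (intro evals_within_Cons evals_within_Nil that)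
    from eval_within_Call[OF this assms(1)] that(3) assms(2)
    have "eval_within P ?\<rho> (Call f [e, e']) (enc (a = b)) (Suc (2 + (2 + 0) + (40 * size a + 10)))"
      by metis
    then show ?thesis by (rule eval_within_mono) simp
  qed
  have 1: "eval_within P ?\<rho> (Call f [HdE (Var 0), HdE (Var 1)]) (enc (u1 = dhd v)) (40 * size u1 + 15)"
    using eval_within_HdE[OF var(1)] eval_within_HdE[OF var(2)]
    by (intro call Dcons) (simp_all add: numeral_2_eq_2)
  have 2: "eval_within P ?\<rho> (Call f [TlE (Var 0), TlE (Var 1)]) (enc (u2 = dtl v)) (40 * size u2 + 15)"
    using eval_within_TlE[OF var(1)] eval_within_TlE[OF var(2)]
    by (intro call Dcons) (simp_all add: numeral_2_eq_2)
  have no: "eval_within P ?\<rho> NilE Dnil c" if "0 < c" for c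
    using that eval_within_mono[OF eval_within_NilE] by simp
  let ?c = "Suc (40 * size u2 + 15)"
  have 3: "eval_within P ?\<rho> (IfE (Call f [HdE (Var 0), HdE (Var 1)]) (Call f [TlE (Var 0), TlE (Var 1)]) NilE)
      (enc (u1 = dhd v \<and> u2 = dtl v)) (Suc (40 * size u1 + 15 + ?c))"
    by (rule eval_within_IfE[OF 1])
      (use no eval_within_mono[OF 2] in \<open>auto simp: enc_bool_def\<close>)
  let ?d = "Suc (40 * size u1 + 15 + ?c)"
  have 4: "eval_within P ?\<rho> (IfE (Var 1)
       (IfE (Call f [HdE (Var 0), HdE (Var 1)]) (Call f [TlE (Var 0), TlE (Var 1)]) NilE) NilE)
      (enc (Dcons u1 u2 = v)) (Suc (Suc 0 + ?d))"
  proof (rule eval_within_IfE[OF var(2)])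
    show "eval_within P ?\<rho> (IfE (Call f [HdE (Var 0), HdE (Var 1)]) (Call f [TlE (Var 0), TlE (Var 1)]) NilE)
      (enc (Dcons u1 u2 = v)) ?d" if "v \<noteq> Dnil"
      using 3 that by (cases v) auto
    show "eval_within P ?\<rho> NilE (enc (Dcons u1 u2 = v)) ?d" if "v = Dnil"
      using no that by simp
  qed
  have "eval_within P ?\<rho> (equality_body f) (enc (Dcons u1 u2 = v)) (Suc (Suc 0 + Suc (Suc 0 + ?d)))"
    unfolding equality_body_def by (rule eval_within_IfE[OF var(1)]) (use 4 in simp_all)
  then show ?case by (rule eval_within_mono) simp
qed

lemma feasible_eq [feas]:
  assumes "feasible E a" "feasible E b"
  shows "feasible E (\<lambda>s. a s = b s)"
proof (rule feasibleI)
  show "poly_bounded E (\<lambda>s. size (enc (a s = b s)))"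
    by (rule poly_bounded_mono[OF poly_bounded_const size_enc_bool])
  fix l
  obtain Q1 e1 c1 where Q1: "poly_bounded E c1" "computes E l Q1 e1 a c1"
    using feasibleE[OF assms(1)] by blast
  obtain Q2 e2 c2 where Q2: "poly_bounded E c2" "computes E (l + length Q1) Q2 e2 b c2"
    using feasibleE[OF assms(2)] by blast
  let ?f = "l + length Q1 + length Q2"
  let ?Q = "Q1 @ Q2 @ [equality_body ?f]"
  let ?c = "\<lambda>s. Suc (c1 s + (c2 s + 0) + (40 * size (enc (a s)) + 10))"
  have "poly_bounded E ?c" by (intro bounds Q1 Q2 assms)
  moreover have "computes E l ?Q (Call ?f [e1, e2]) (\<lambda>s. a s = b s) ?c"
  proof (intro computesI eval_within_Call)
    fix P :: program and s assume P: "length P = l"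
    let ?\<rho> = "map (\<lambda>f. f s) E"
    from P have "eval_within (P @ ?Q) ?\<rho> e1 (enc (a s)) (c1 s)"
      by (rule computesD[OF Q1(2)])
    moreover have "eval_within (P @ ?Q) ?\<rho> e2 (enc (b s)) (c2 s)"
      using computesD[OF Q2(2), of "P @ Q1" "[equality_body ?f]" s] P by simp
    ultimately show "evals_within (P @ ?Q) ?\<rho> [e1, e2] [enc (a s), enc (b s)] (c1 s + (c2 s + 0))"
      by (intro evals_within_Cons evals_within_Nil)
    have f: "(P @ ?Q) ! ?f = equality_body ?f"
      using P by (simp add: nth_append)
    show "?f < length (P @ ?Q)" using P by simp
    from eval_within_equality_body[OF this f, of "enc (a s)" "enc (b s)"]
    show "eval_within (P @ ?Q) [enc (a s), enc (b s)] ((P @ ?Q) ! ?f) (enc (a s = b s))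
        (40 * size (enc (a s)) + 10)"
      unfolding f by simp
  qed
  ultimately show "\<exists>Q e c. poly_bounded E c \<and> computes E l Q e (\<lambda>s. a s = b s) c" by blast
qed

text \<open>
  The projections are constants of their own, and not \<open>fst\<close> and \<open>snd\<close>, so that at most one closure rule
  applies to each subterm of a loop body.
\<close>

type_synonym ('s, 'x, 'r) inner = "'s \<times> 'x \<times> 'r"

definition outer :: "('s, 'x, 'r) inner \<Rightarrow> 's" where "outer p = fst p"
definition elem :: "('s, 'x, 'r) inner \<Rightarrow> 'x" where "elem p = fst (snd p)"
definition accu :: "('s, 'x, 'r) inner \<Rightarrow> 'r" where "accu p = snd (snd p)"

section \<open>Loops: folds over lists\<close>

definition loop_env :: "('s \<Rightarrow> data) list \<Rightarrow> (('s, 'x :: code, 'r :: code) inner \<Rightarrow> data) list" where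
  "loop_env E = (\<lambda>p. enc (elem p)) # (\<lambda>p. enc (accu p)) # map (\<lambda>f p. f (outer p)) E"

lemma inner_simps [simp]: "outer (s, x, r) = s" "elem (s, x, r) = x" "accu (s, x, r) = r"
  by (simp_all add: outer_def elem_def accu_def)

lemma env_size_loop_env:
  "env_size (loop_env E) p = env_size E (outer p) + size (enc (elem p)) + size (enc (accu p))"
  by (simp add: env_size_def loop_env_def o_def)

lemma map_loop_env:
  "map (\<lambda>f. f p) (loop_env E) = enc (elem p) # enc (accu p) # map (\<lambda>f. f (outer p)) E"
  by (simp add: loop_env_def)

lemma feasible_elem [feas]: "feasible (loop_env E) elem"
  by (rule feasible_env) (simp add: loop_env_def)

lemma feasible_accu [feas]: "feasible (loop_env E) accu"
  by (rule feasible_env) (simp add: loop_env_def)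

lemma poly_bounded_outer:
  assumes "poly_bounded E c"
  shows "poly_bounded (loop_env E) (\<lambda>p. c (outer p))"
proof -
  from assms obtain d where "\<And>s. c s \<le> env_size E s ^ d"
    unfolding poly_bounded_def by blast
  then have "c (outer p) \<le> env_size (loop_env E) p ^ d" for p
    by (rule order_trans) (simp add: power_mono env_size_loop_env)
  then show ?thesis unfolding poly_bounded_def by blast
qed

text \<open>Inside a loop body the outer variables are shifted by two places, behind the element and
  the accumulator. Instead of renaming variables in \<open>e\<close>, it is made a function and
  called on the variables from position 2 on.\<close>

lemma feasible_outer:
  fixes E :: "('s \<Rightarrow> data) list"
  assumes "feasible E f"
  shows "feasible (loop_env E) (\<lambda>p :: ('s, 'x :: code, 'r :: code) inner. f (outer p))"
proof (rule feasibleI)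
  show "poly_bounded (loop_env E) (\<lambda>p. size (enc (f (outer p))))"
    by (rule poly_bounded_outer[OF feasible_bounded[OF assms]])
  fix l
  obtain Q e c where Q: "poly_bounded E c" "computes E l Q e f c"
    using feasibleE[OF assms] by blast
  let ?n = "length E" and ?f = "l + length Q"
  let ?e = "Call ?f (map Var [2..<2 + ?n])"
  have "poly_bounded (loop_env E) (\<lambda>p :: ('s, 'x, 'r) inner. Suc (?n + c (outer p)))"
    by (intro bounds poly_bounded_outer Q)
  moreover have "computes (loop_env E) l (Q @ [e]) ?e (\<lambda>p :: ('s, 'x, 'r) inner. f (outer p)) (\<lambda>p. Suc (?n + c (outer p)))"
  proof (intro computesI eval_within_Call)
    fix P :: program and p :: "('s, 'x, 'r) inner" assume P: "length P = l"
    let ?\<rho> = "map (\<lambda>f. f (outer p)) E"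
    show "evals_within (P @ Q @ [e]) (map (\<lambda>f. f p) (loop_env E)) (map Var [2..<2 + ?n]) ?\<rho> ?n"
      using evals_within_Vars[of "[enc (elem p), enc (accu p)]" 2 "P @ Q @ [e]" ?\<rho>]
      by (simp add: map_loop_env)
    show "?f < length (P @ Q @ [e])" using P by simp
    show "eval_within (P @ Q @ [e]) ?\<rho> ((P @ Q @ [e]) ! ?f) (enc (f (outer p))) (c (outer p))"
      using computesD[OF Q(2) P] P by (simp add: nth_append)
  qed
  ultimately show "\<exists>Q e c. poly_bounded (loop_env E) c \<and>
      computes (loop_env E) l Q e (\<lambda>p :: ('s, 'x, 'r) inner. f (outer p)) c"
    by blast
qed

text \<open>The loop sits at position \<open>f\<close>, the step function at \<open>f + 1\<close>
  and the initial value at \<open>f + 2\<close>. The step receives element, accumulator and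
  environment in the order of \<open>loop_env\<close>.\<close>

definition fold_body :: "nat \<Rightarrow> nat \<Rightarrow> expr" where
  "fold_body n f = IfE (Var 0)
     (Call (f + 1) (HdE (Var 0) # Call f (TlE (Var 0) # map Var [1..<1 + n]) # map Var [1..<1 + n]))
     (Call (f + 2) (map Var [1..<1 + n]))"

text \<open>The step is assumed to cost at most \<open>cg\<close> only on accumulators that really
  occur, that is, on folds over suffixes of \<open>xs\<close>. A bound over all conceivable
  accumulators would not exist in general.\<close>

lemma eval_within_fold_body:
  assumes n: "length \<rho> = n" and P: "f + 2 < length P" and code: "P ! f = fold_body n f" "P ! (f + 1) = eg" "P ! (f + 2) = ea"
    and base: "eval_within P \<rho> ea (enc a) ca"
    and step: "\<And>x ys. suffix (x # ys) xs \<Longrightarrow>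
      eval_within P (enc x # enc (foldr g ys a) # \<rho>) eg (enc (foldr g (x # ys) a)) cg"
  shows "suffix ys xs \<Longrightarrow> eval_within P (enc ys # \<rho>) (fold_body n f) (enc (foldr g ys a))
    (length ys * (cg + 2 * n + 8) + (ca + n + 3))"
proof (induction ys)
  case Nil
  have vars: "evals_within P (enc ([] :: 'a list) # \<rho>) (map Var [1..<1 + n]) \<rho> (n)"
    using evals_within_Vars[of "[enc ([] :: 'a list)]" 1 P \<rho>] n by simp
  have "eval_within P (enc ([] :: 'a list) # \<rho>) (Call (f + 2) (map Var [1..<1 + n])) (enc a)
      (Suc (n + ca))"
    by (rule eval_within_Call[OF vars]) (use P base code(3) in auto)
  then have "eval_within P (enc ([] :: 'a list) # \<rho>) (fold_body n f) (enc a)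
      (Suc (Suc 0 + Suc (n + ca)))"
    unfolding fold_body_def by (intro eval_within_IfE[where u = Dnil] eval_within_Var) simp_all
  then show ?case by (auto intro: eval_within_mono)
next
  case (Cons y ys)
  let ?\<rho> = "enc (y # ys) # \<rho>"
  have vars: "evals_within P ?\<rho> (map Var [1..<1 + n]) \<rho> (n)"
    using evals_within_Vars[of "[enc (y # ys)]" 1 P \<rho>] n by simp
  have var: "eval_within P ?\<rho> (Var 0) (enc (y # ys)) (Suc 0)"
    by (rule eval_within_Var) simp_all
  let ?c = "length ys * (cg + 2 * n + 8) + (ca + n + 3)"
  from Cons.prems have "suffix ys xs" by (rule suffix_ConsD)
  from Cons.IH[OF this] have "eval_within P (enc ys # \<rho>) (P ! f) (enc (foldr g ys a)) ?c"
    using code(1) by simp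
  then have "eval_within P ?\<rho> (Call f (TlE (Var 0) # map Var [1..<1 + n])) (enc (foldr g ys a))
      (Suc ((Suc (Suc 0) + n) + ?c))"
    using P by (intro eval_within_Call[OF evals_within_Cons[OF eval_within_TlE[OF var] vars]]) simp_all
  then have "evals_within P ?\<rho> (HdE (Var 0) # Call f (TlE (Var 0) # map Var [1..<1 + n])
      # map Var [1..<1 + n]) (enc y # enc (foldr g ys a) # \<rho>)
      (Suc (Suc 0) + (Suc ((Suc (Suc 0) + n) + ?c) + n))"
    by (intro evals_within_Cons vars eval_within_HdE[OF var]) simp_all
  from eval_within_Call[OF this, of "f + 1"] step[OF Cons.prems] P code(2)
  have "eval_within P ?\<rho> (Call (f + 1) (HdE (Var 0) # Call f (TlE (Var 0) # map Var [1..<1 + n])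
      # map Var [1..<1 + n])) (enc (foldr g (y # ys) a))
      (Suc (Suc (Suc 0) + (Suc ((Suc (Suc 0) + n) + ?c) + n) + cg))"
    by simp
  then have "eval_within P ?\<rho> (fold_body n f) (enc (foldr g (y # ys) a))
      (Suc (Suc 0 + Suc (Suc (Suc 0) + (Suc ((Suc (Suc 0) + n) + ?c) + n) + cg)))"
    unfolding fold_body_def by (intro eval_within_IfE[OF var]) simp_all
  then show ?case by (rule eval_within_mono) simp
qed

text \<open>A feasible step does not make a fold feasible, because its output may grow by a power in
  each round. The bound \<open>b\<close> on all intermediate accumulators excludes this; since
  \<open>foldr\<close> works from the right, these are the folds over suffixes.\<close>

lemma feasible_foldr:
  assumes xs: "feasible E xs" and a: "feasible E a"
    and g: "feasible (loop_env E) (\<lambda>p. g (outer p) (elem p) (accu p))"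
    and b: "poly_bounded E b" "\<And>s ys. suffix ys (xs s) \<Longrightarrow> size (enc (foldr (g s) ys (a s))) \<le> b s"
  shows "feasible E (\<lambda>s. foldr (g s) (xs s) (a s))"
proof (rule feasibleI)
  show "poly_bounded E (\<lambda>s. size (enc (foldr (g s) (xs s) (a s))))"
    by (rule poly_bounded_mono[OF b(1)]) (simp add: b(2))
  fix l
  obtain Q1 e1 c1 where Q1: "poly_bounded E c1" "computes E l Q1 e1 xs c1"
    using feasibleE[OF xs] by blast
  obtain Q2 e2 c2 where Q2: "poly_bounded E c2" "computes E (l + length Q1) Q2 e2 a c2"
    using feasibleE[OF a] by blast
  obtain Q3 e3 c3 where Q3: "poly_bounded (loop_env E) c3" "computes (loop_env E) (l + length Q1 + length Q2) Q3 e3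
      (\<lambda>p. g (outer p) (elem p) (accu p)) c3"
    using feasibleE[OF g] by blast
  from Q3(1) obtain d where d: "\<And>p. c3 p \<le> env_size (loop_env E) p ^ d"
    unfolding poly_bounded_def by blast
  \<comment> \<open>The environment of a step consists of the outer environment, one element and one
    accumulator; the three summands bound their sizes.\<close>
  define cg where "cg = (\<lambda>s. (env_size E s + size (enc (xs s)) + b s) ^ d)"
  have cg: "c3 (s, x, foldr (g s) ys (a s)) \<le> cg s" if "suffix (x # ys) (xs s)" for s x ys
  proof -
    from that have "x \<in> set (xs s)" by (auto simp: suffix_def)
    then have "size (enc x) \<le> size (enc (xs s))" using size_enc_member by fastforce
    moreover have "size (enc (foldr (g s) ys (a s))) \<le> b s"
      using that by (intro b(2)) (rule suffix_ConsD)
    ultimately have "env_size (loop_env E) (s, x, foldr (g s) ys (a s)) ^ d \<le> cg s"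
      unfolding cg_def env_size_loop_env by (intro power_mono) simp_all
    with d show ?thesis by (rule order_trans)
  qed
  let ?n = "length E" and ?f = "l + length Q1 + length Q2 + length Q3"
  let ?R = "[fold_body ?n ?f, e3, e2]"
  let ?Q = "Q1 @ Q2 @ Q3 @ ?R"
  let ?c = "\<lambda>s. Suc ((c1 s + ?n) + (length (xs s) * (cg s + 2 * ?n + 8) + (c2 s + ?n + 3)))"
  have "poly_bounded E ?c"
    unfolding cg_def by (intro bounds b Q1 Q2 xs)
  moreover have "computes E l ?Q (Call ?f (e1 # map Var [0..<0 + ?n])) (\<lambda>s. foldr (g s) (xs s) (a s)) ?c"
  proof (intro computesI eval_within_Call)
    fix P :: program and s assume P: "length P = l"
    let ?P = "P @ ?Q" and ?\<rho> = "map (\<lambda>f. f s) E"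
    from P have "eval_within ?P ?\<rho> e1 (enc (xs s)) (c1 s)"
      by (rule computesD[OF Q1(2)])
    then show "evals_within ?P ?\<rho> (e1 # map Var [0..<0 + ?n]) (enc (xs s) # ?\<rho>) (c1 s + ?n)"
      using evals_within_Vars[of "[]" 0 ?P ?\<rho>] by (intro evals_within_Cons) simp_all
    show "?f < length ?P" using P by simp
    have f: "?P ! ?f = fold_body ?n ?f"
      using P by (simp add: nth_append)
    show "eval_within ?P (enc (xs s) # ?\<rho>) (?P ! ?f) (enc (foldr (g s) (xs s) (a s)))
        (length (xs s) * (cg s + 2 * ?n + 8) + (c2 s + ?n + 3))"
      unfolding f
    proof (rule eval_within_fold_body[where xs = "xs s" and ?\<rho> = ?\<rho> and eg = e3 and ea = e2])
      show "length ?\<rho> = ?n" by simp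
      show "?f + 2 < length ?P" using P by simp
      show "?P ! ?f = fold_body ?n ?f" by (fact f)
      show "?P ! (?f + 1) = e3" "?P ! (?f + 2) = e2"
        using P by (simp_all add: nth_append)
      show "eval_within ?P ?\<rho> e2 (enc (a s)) (c2 s)"
        using computesD[OF Q2(2), of "P @ Q1" "Q3 @ ?R" s] P by simp
      show "eval_within ?P (enc x # enc (foldr (g s) ys (a s)) # ?\<rho>) e3 (enc (foldr (g s) (x # ys) (a s))) (cg s)"
        if "suffix (x # ys) (xs s)" for x ys
        using computesD[OF Q3(2), of "P @ Q1 @ Q2" ?R "(s, x, foldr (g s) ys (a s))"] P cg[OF that]
        by (simp add: map_loop_env eval_within_mono)
    qed simp
  qed
  ultimately show "\<exists>Q e c. poly_bounded E c \<and> computes E l Q e (\<lambda>s. foldr (g s) (xs s) (a s)) c" by blast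
qed

section \<open>List operations as folds with bounded accumulators\<close>

lemma feasible_map [feas]:
  fixes g :: "'s \<Rightarrow> 'x :: code \<Rightarrow> 'y :: code"
  assumes xs: "feasible E xs" and g: "feasible (loop_env E) (\<lambda>p :: ('s, 'x, 'y list) inner. g (outer p) (elem p))"
  shows "feasible E (\<lambda>s. map (g s) (xs s))"
proof -
  obtain d where d: "\<And>p :: ('s, 'x, 'y list) inner. size (enc (g (outer p) (elem p))) \<le> env_size (loop_env E) p ^ d"
    using feasible_bounded[OF g] unfolding poly_bounded_def by blast
  define b where "b = (\<lambda>s. length (xs s) * ((env_size E s + size (enc (xs s))) ^ d + 1))"
  have b: "size (enc (map (g s) ys)) \<le> b s" if "suffix ys (xs s)" for s ys
  proof -
    have "size (enc (g s x)) \<le> (env_size E s + size (enc (xs s))) ^ d" if "x \<in> set (xs s)" for x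
    proof -
      have "size (enc (g s x)) \<le> (env_size E s + size (enc x)) ^ d"
        \<comment> \<open>The value of \<open>g\<close> does not depend on the accumulator, so the
          empty one is chosen, whose code has size 0.\<close>
        using d[of "(s, x, [])"] by (simp add: env_size_loop_env)
      also have "\<dots> \<le> (env_size E s + size (enc (xs s))) ^ d"
        using size_enc_member[OF that] by (intro power_mono) simp_all
      finally show ?thesis .
    qed
    then have "size (enc (map (g s) ys)) \<le> length (map (g s) ys) * ((env_size E s + size (enc (xs s))) ^ d + 1)"
      using set_mono_suffix[OF that] by (intro size_enc_list_le) auto
    also have "\<dots> \<le> b s"
      unfolding b_def using suffix_length_le[OF that] by (intro mult_le_mono1) simp
    finally show ?thesis .
  qed
  have "feasible E (\<lambda>s. foldr (\<lambda>x r. g s x # r) (xs s) [])"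
  proof (rule feasible_foldr)
    show "poly_bounded E b"
      unfolding b_def by (intro bounds xs)
    have "foldr (\<lambda>x r. g s x # r) ys [] = map (g s) ys" for s ys
      by (induction ys) simp_all
    with b show "size (enc (foldr (\<lambda>x r. g s x # r) ys [])) \<le> b s" if "suffix ys (xs s)" for s ys
      using that by simp
  qed (intro feas xs g)+
  moreover have "foldr (\<lambda>x r. g s x # r) ys [] = map (g s) ys" for s ys
    by (induction ys) simp_all
  ultimately show ?thesis by simp
qed

lemma feasible_append [feas]:
  assumes "feasible E xs" "feasible E ys"
  shows "feasible E (\<lambda>s. xs s @ ys s)"
proof -
  have foldr_Cons: "foldr (#) us vs = us @ vs" for us vs :: "'b list"
    by (induction us) simp_all
  have "feasible E (\<lambda>s. foldr (#) (xs s) (ys s))"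
  proof (rule feasible_foldr)
    show "poly_bounded E (\<lambda>s. size (enc (xs s)) + size (enc (ys s)))"
      by (intro bounds assms)
    show "size (enc (foldr (#) us (ys s))) \<le> size (enc (xs s)) + size (enc (ys s))"
      if "suffix us (xs s)" for s us
      using that unfolding foldr_Cons by (auto simp: suffix_def)
  qed (intro feas assms)+
  then show ?thesis by (simp add: foldr_Cons)
qed

lemma feasible_concat [feas]:
  assumes "feasible E xss"
  shows "feasible E (\<lambda>s. concat (xss s))"
proof -
  have le: "size (enc (concat yss)) \<le> size (enc yss)" for yss :: "'b list list"
    by (induction yss) simp_all
  have "feasible E (\<lambda>s. foldr (@) (xss s) [])"
  proof (rule feasible_foldr)
    show "poly_bounded E (\<lambda>s. size (enc (xss s)))"
      by (intro bounds assms)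
    show "size (enc (foldr (@) yss [])) \<le> size (enc (xss s))" if "suffix yss (xss s)" for s yss
      using that le[of yss] by (auto simp: suffix_def concat_conv_foldr[symmetric])
  qed (intro feas assms)+
  then show ?thesis by (simp add: concat_conv_foldr)
qed

lemma feasible_filter [feas]:
  fixes g :: "'s \<Rightarrow> 'x :: code \<Rightarrow> bool"
  assumes xs: "feasible E xs" and g: "feasible (loop_env E) (\<lambda>p :: ('s, 'x, 'x list) inner. g (outer p) (elem p))"
  shows "feasible E (\<lambda>s. filter (g s) (xs s))"
proof -
  have filter_eq: "foldr (\<lambda>x r. if g s x then x # r else r) ys [] = filter (g s) ys" for s ys
    by (induction ys) simp_all
  have le: "size (enc (filter P ys)) \<le> size (enc ys)" for P :: "'x \<Rightarrow> bool" and ys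
    by (induction ys) simp_all
  have "feasible E (\<lambda>s. foldr (\<lambda>x r. if g s x then x # r else r) (xs s) [])"
  proof (rule feasible_foldr)
    show "poly_bounded E (\<lambda>s. size (enc (xs s)))" by (intro bounds xs)
    show "size (enc (foldr (\<lambda>x r. if g s x then x # r else r) ys [])) \<le> size (enc (xs s))"
      if "suffix ys (xs s)" for s ys
      using that le[of "g s" ys] unfolding filter_eq by (auto simp: suffix_def)
  qed (intro feas xs g)+
  then show ?thesis by (simp add: filter_eq)
qed

lemma feasible_ex [feas]:
  fixes g :: "'s \<Rightarrow> 'x :: code \<Rightarrow> bool"
  assumes xs: "feasible E xs" and g: "feasible (loop_env E) (\<lambda>p :: ('s, 'x, bool) inner. g (outer p) (elem p))"
  shows "feasible E (\<lambda>s. \<exists>x\<in>set (xs s). g s x)"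
proof -
  have ex_eq: "foldr (\<lambda>x r. g s x \<or> r) ys False \<longleftrightarrow> (\<exists>x\<in>set ys. g s x)" for s ys
    by (induction ys) simp_all
  have "feasible E (\<lambda>s. foldr (\<lambda>x r. g s x \<or> r) (xs s) False)"
    by (rule feasible_foldr[OF xs _ _ poly_bounded_const size_enc_bool]) (intro feas xs g)+
  then show ?thesis by (simp add: ex_eq)
qed

lemma feasible_all [feas]:
  fixes g :: "'s \<Rightarrow> 'x :: code \<Rightarrow> bool"
  assumes xs: "feasible E xs" and g: "feasible (loop_env E) (\<lambda>p :: ('s, 'x, bool) inner. g (outer p) (elem p))"
  shows "feasible E (\<lambda>s. \<forall>x\<in>set (xs s). g s x)"
proof -
  have all_eq: "foldr (\<lambda>x r. g s x \<and> r) ys True \<longleftrightarrow> (\<forall>x\<in>set ys. g s x)" for s ys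
    by (induction ys) simp_all
  have "feasible E (\<lambda>s. foldr (\<lambda>x r. g s x \<and> r) (xs s) True)"
    by (rule feasible_foldr[OF xs _ _ poly_bounded_const size_enc_bool]) (intro feas xs g)+
  then show ?thesis by (simp add: all_eq)
qed

lemma feasible_member [feas]:
  assumes "feasible E a" "feasible E xs"
  shows "feasible E (\<lambda>s. a s \<in> set (xs s))"
proof -
  have "feasible E (\<lambda>s. \<exists>x\<in>set (xs s). a s = x)"
    by (intro feas assms feasible_outer)
  then show ?thesis by simp
qed

lemma feasible_not [feas]:
  assumes "feasible E a"
  shows "feasible E (\<lambda>s. \<not> a s)"
proof -
  have "feasible E (\<lambda>s. if a s then False else True)" by (intro feas assms)
  moreover have "(\<lambda>s. if a s then False else True) = (\<lambda>s. \<not> a s)" by auto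
  ultimately show ?thesis by simp
qed

text \<open>The number of copies is fixed with the program and not computed from the input, so the
  operation unfolds into finitely many applications of \<open>feasible_Cons\<close>. It is used with
  \<open>k - 2\<close> copies.\<close>

lemma feasible_replicate [feas]: "feasible E a \<Longrightarrow> feasible E (\<lambda>s. replicate n (a s))"
  by (induction n) (auto intro: feas)

lemma feasible_product [feas]:
  assumes "feasible E xs" "feasible E ys"
  shows "feasible E (\<lambda>s. List.product (xs s) (ys s))"
  unfolding product_concat_map by (intro feas assms feasible_outer)

section \<open>The algorithm\<close>

definition lookup :: "'b \<Rightarrow> ('a \<times> 'b) list \<Rightarrow> 'a \<Rightarrow> 'b" where
  "lookup d t x = foldr (\<lambda>p r. if fst p = x then snd p else r) t d"

lemma lookup_simps [simp]:
  "lookup d [] x = d" "lookup d (p # t) x = (if fst p = x then snd p else lookup d t x)"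
  by (simp_all add: lookup_def)

lemma feasible_lookup [feas]:
  assumes "feasible E d" "feasible E t" "feasible E x"
  shows "feasible E (\<lambda>s. lookup (d s) (t s) (x s))"
  unfolding lookup_def
proof (rule feasible_foldr)
  have le: "size (enc (lookup c u y)) \<le> size (enc u) + size (enc c)" for c and u :: "('c \<times> 'b) list" and y
    by (induction u) auto
  show "poly_bounded E (\<lambda>s. size (enc (t s)) + size (enc (d s)))"
    by (intro bounds assms)
  show "size (enc (foldr (\<lambda>p r. if fst p = x s then snd p else r) ys (d s))) \<le> size (enc (t s)) + size (enc (d s))"
    if "suffix ys (t s)" for s ys
    using that le[of "d s" ys "x s"] unfolding lookup_def by (auto simp: suffix_def)
qed (intro feas assms feasible_outer)+

text \<open>Assignments map vertices of \<open>G\<close> to vertices of \<open>H\<close>; \<open>val\<close> has the junk value 0 outside the domain.\<close>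

type_synonym assignment = "(nat \<times> nat) list"

definition val :: "assignment \<Rightarrow> nat \<Rightarrow> nat" where
  "val t x = lookup 0 t x"

lemma feasible_val [feas]: "feasible E t \<Longrightarrow> feasible E x \<Longrightarrow> feasible E (\<lambda>s. val (t s) (x s))"
  unfolding val_def by (intro feas)

text \<open>This is h(x; a, b, ..., b, c) taken vertex by vertex, with values read from the table
  \<open>T\<close> of \<open>h\<close>. Each table entry is regrouped so that vertex and tuple
  together form the key; for \<open>k \<ge> 2\<close> the tuple built here has length
  \<open>k\<close>.\<close>

definition maltsev ::
  "nat \<Rightarrow> (nat \<times> nat list \<times> nat) list \<Rightarrow> nat list \<Rightarrow> assignment \<Rightarrow> assignment \<Rightarrow> assignment \<Rightarrow> assignment" where
  "maltsev k T V t u v = map (\<lambda>x. (x, lookup 0 (map (\<lambda>(y, as, c). ((y, as), c)) T)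
     (x, val t x # replicate (k - 2) (val u x) @ [val v x]))) V"

lemma feasible_maltsev [feas]:
  assumes "feasible E T" "feasible E V" "feasible E t" "feasible E u" "feasible E v"
  shows "feasible E (\<lambda>s. maltsev k (T s) (V s) (t s) (u s) (v s))"
  unfolding maltsev_def by (intro feas assms feasible_outer)

text \<open>
  Two exchange steps, at \<open>i\<close> and at \<open>j\<close>, reach from \<open>t\<close> every pair of values at \<open>i\<close> and \<open>j\<close> that is
  compatible with the values of \<open>t\<close> before \<open>i\<close>.
\<close>

definition expand ::
  "(assignment \<Rightarrow> assignment \<Rightarrow> assignment \<Rightarrow> assignment) \<Rightarrow> nat \<Rightarrow> (assignment \<times> assignment) list \<Rightarrow>
   nat \<Rightarrow> (assignment \<times> assignment) list \<Rightarrow> assignment list \<Rightarrow> (assignment \<times> assignment) list" where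
  "expand m i X j Y ts =
     concat (map (\<lambda>t. concat (map (\<lambda>p. concat (map (\<lambda>q.
       if val (fst p) i = val t i \<and> val (fst q) j = val (m t (fst p) (snd p)) j
       then [(t, m (m t (fst p) (snd p)) (fst q) (snd q))] else []) Y)) X)) ts)"

lemma feasible_expand [feas]:
  assumes "feasible E T" "feasible E V"
    and "feasible E i" "feasible E X" "feasible E j" "feasible E Y" "feasible E ts"
  shows "feasible E (\<lambda>s. expand (maltsev k (T s) (V s)) (i s) (X s) (j s) (Y s) (ts s))"
  unfolding expand_def by (intro feas assms feasible_outer)

text \<open>A list of length at most one plays the part of an optional result.\<close>

definition find_pair :: "nat \<Rightarrow> nat \<times> nat \<Rightarrow> (assignment \<times> assignment) list \<Rightarrow> (assignment \<times> assignment) list" where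
  "find_pair z c W = foldr (\<lambda>p r. if (val (fst p) z, val (snd p) z) = c then [p] else r) W []"

lemma find_pair_simps [simp]:
  "find_pair z c [] = []"
  "find_pair z c (p # W) = (if (val (fst p) z, val (snd p) z) = c then [p] else find_pair z c W)"
  by (simp_all add: find_pair_def)

lemma feasible_find_pair [feas]:
  assumes "feasible E z" "feasible E c" "feasible E W"
  shows "feasible E (\<lambda>s. find_pair (z s) (c s) (W s))"
  unfolding find_pair_def
proof (rule feasible_foldr)
  have le: "size (enc (find_pair z c W)) \<le> size (enc W)" for z c W
    by (induction W) auto
  show "poly_bounded E (\<lambda>s. size (enc (W s)))" by (intro bounds assms)
  show "size (enc (foldr (\<lambda>p r. if (val (fst p) (z s), val (snd p) (z s)) = c s then [p] else r) ys []))
      \<le> size (enc (W s))" if "suffix ys (W s)" for s ys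
    using that le[of "z s" "c s" ys] unfolding find_pair_def by (auto simp: suffix_def)
qed (intro feas assms feasible_outer)+

text \<open>Pruning keeps the lists at most as long as the square of the number of vertices of \<open>H\<close>.\<close>

definition prune :: "nat list \<Rightarrow> nat \<Rightarrow> (assignment \<times> assignment) list \<Rightarrow> (assignment \<times> assignment) list" where
  "prune B z W = concat (map (\<lambda>c. find_pair z c W) (List.product B B))"

lemma feasible_prune [feas]:
  assumes "feasible E z" "feasible E W"
  shows "feasible E (\<lambda>s. prune B (z s) (W s))"
  unfolding prune_def by (intro feas assms feasible_outer)

type_synonym state = "(nat \<times> (assignment \<times> assignment) list) list"

text \<open>If \<open>z\<close> occurs in \<open>S\<close>, it has already been moved to the front of \<open>S\<close>, hence \<open>tl S\<close>.\<close>

definition swap_step ::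
  "(assignment \<Rightarrow> assignment \<Rightarrow> assignment \<Rightarrow> assignment) \<Rightarrow> nat list \<Rightarrow> nat \<Rightarrow>
   nat \<times> (assignment \<times> assignment) list \<Rightarrow> state \<Rightarrow> state" where
  "swap_step m B z e S = (if z \<in> set (map fst S)
     then (z, prune B z (expand m (fst e) (snd e) z (lookup [] S z) (map fst (lookup [] S z)))) #
       (fst e, prune B (fst e) (filter (\<lambda>(t, t'). val t z = val t' z)
          (expand m (fst e) (snd e) z (lookup [] S z) (map fst (snd e))))) # tl S
     else e # S)"

lemma feasible_swap_step [feas]:
  assumes "feasible E T" "feasible E V" "feasible E z" "feasible E e" "feasible E S"
  shows "feasible E (\<lambda>s. swap_step (maltsev k (T s) (V s)) B (z s) (e s) (S s))"
  unfolding swap_step_def by (intro feas assms feasible_outer)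


section \<open>Size bounds for states\<close>

definition entry_bounded :: "nat \<Rightarrow> nat \<times> (assignment \<times> assignment) list \<Rightarrow> bool" where
  "entry_bounded b e \<longleftrightarrow> size (enc (fst e)) \<le> b \<and> length (snd e) \<le> b \<and>
     (\<forall>p \<in> set (snd e). size (enc (fst p)) \<le> b \<and> size (enc (snd p)) \<le> b)"

lemma size_enc_entry_bounded:
  assumes "entry_bounded b e"
  shows "size (enc e) \<le> b + b * (2 * b + 2) + 1"
proof -
  have "size (enc (snd e)) \<le> length (snd e) * ((2 * b + 1) + 1)"
  proof (rule size_enc_list_le)
    fix p assume "p \<in> set (snd e)"
    with assms have "size (enc (fst p)) \<le> b" "size (enc (snd p)) \<le> b"
      unfolding entry_bounded_def by auto
    then show "size (enc p) \<le> 2 * b + 1" by (cases p) simp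
  qed
  also have "\<dots> \<le> b * (2 * b + 2)"
    using assms unfolding entry_bounded_def by (intro mult_le_mono) simp_all
  finally show ?thesis using assms unfolding entry_bounded_def by (cases e) simp
qed

definition state_bounded :: "nat \<Rightarrow> state \<Rightarrow> bool" where
  "state_bounded b S \<longleftrightarrow> (\<forall>e \<in> set S. entry_bounded b e)"

lemma state_bounded_simps [simp]:
  "state_bounded b []" "state_bounded b (e # S) \<longleftrightarrow> entry_bounded b e \<and> state_bounded b S"
  by (simp_all add: state_bounded_def)

lemma state_bounded_size_enc: "state_bounded b S \<Longrightarrow> size (enc S) \<le> length S * (b + b * (2 * b + 2) + 2)"
  using size_enc_list_le[of S "b + b * (2 * b + 2) + 1"] size_enc_entry_bounded
  unfolding state_bounded_def by simp

lemma entry_bounded_self: "entry_bounded (size (enc e)) e"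
proof -
  have "size (enc (fst p)) \<le> size (enc e) \<and> size (enc (snd p)) \<le> size (enc e)" if "p \<in> set (snd e)" for p
    using size_enc_member[OF that] by (cases e; cases p) simp
  then show ?thesis
    unfolding entry_bounded_def using length_le_size_enc[of "snd e"] by (cases e) auto
qed

lemma entry_bounded_mono: "entry_bounded b e \<Longrightarrow> b \<le> c \<Longrightarrow> entry_bounded c e"
  unfolding entry_bounded_def by (meson order_trans)

text \<open>The code size of a state bounds every size and length inside it, which provides the
  bound with which the loops start.\<close>

lemma state_bounded_self:
  assumes "size (enc S) \<le> b" "set S' \<subseteq> set S"
  shows "state_bounded b S'"
  unfolding state_bounded_def
proof
  fix e assume "e \<in> set S'"
  with assms size_enc_member[of e S] have "size (enc e) \<le> b" by fastforce
  with entry_bounded_self show "entry_bounded b e" by (rule entry_bounded_mono)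
qed

lemma length_find_pair: "length (find_pair z c W) \<le> 1"
  by (induction W) auto

lemma length_prune: "length (prune B z W) \<le> length B * length B"
proof -
  have "length (concat (map (\<lambda>c. find_pair z c W) cs)) \<le> length cs" for cs
  proof (induction cs)
    case (Cons c cs)
    with length_find_pair[of z c W] show ?case by simp
  qed simp
  from this[of "List.product B B"] show ?thesis unfolding prune_def by simp
qed

lemma set_find_pair: "set (find_pair z c W) = {} \<or> (\<exists>p \<in> set W. set (find_pair z c W) = {p} \<and> (val (fst p) z, val (snd p) z) = c)"
  by (induction W) auto

lemma set_prune: "set (prune B z W) \<subseteq> set W"
proof
  fix p assume "p \<in> set (prune B z W)"
  then obtain c where "p \<in> set (find_pair z c W)" unfolding prune_def by auto
  with set_find_pair[of z c W] show "p \<in> set W" by auto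
qed

lemma lookup_in_state: "p \<in> set (lookup [] S z) \<Longrightarrow> \<exists>e \<in> set S. p \<in> set (snd e)"
  by (induction S) (auto split: if_splits)

lemma set_expand:
  "r \<in> set (expand m i X j Y ts) \<longleftrightarrow> (\<exists>t \<in> set ts. \<exists>p \<in> set X. \<exists>q \<in> set Y.
     val (fst p) i = val t i \<and> val (fst q) j = val (m t (fst p) (snd p)) j \<and>
     r = (t, m (m t (fst p) (snd p)) (fst q) (snd q)))"
proof -
  have set_if: "r \<in> set (if c then [a] else []) \<longleftrightarrow> c \<and> r = a" for c and a :: "assignment \<times> assignment"
    by auto
  have set_concat_map: "r \<in> set (concat (map f xs)) \<longleftrightarrow> (\<exists>x \<in> set xs. r \<in> set (f x))"
    for f :: "'c \<Rightarrow> (assignment \<times> assignment) list" and xs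
    by auto
  show ?thesis
    by (simp only: expand_def set_concat_map set_if conj_assoc)
qed

text \<open>The fold starts at the end of the state: entries behind \<open>z\<close> are copied, the
  entry of \<open>z\<close> becomes the head, and each earlier entry is then transposed with
  it.\<close>

definition bring :: "(assignment \<Rightarrow> assignment \<Rightarrow> assignment \<Rightarrow> assignment) \<Rightarrow> nat list \<Rightarrow> nat \<Rightarrow> state \<Rightarrow> state" where
  "bring m B z S = foldr (swap_step m B z) S []"

lemma length_swap_step: "length (swap_step m B z e S) = Suc (length S)"
  by (cases S) (auto simp: swap_step_def)

lemma length_foldr_swap_step: "length (foldr (swap_step m B z) S []) = length S"
  by (induction S) (simp_all add: length_swap_step)

lemma entry_bounded_prune:
  assumes "length B * length B \<le> b" "size (enc z) \<le> b"
    and "\<And>p. p \<in> set W \<Longrightarrow> size (enc (fst p)) \<le> b \<and> size (enc (snd p)) \<le> b"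
  shows "entry_bounded b (z, prune B z W)"
  using assms set_prune[of B z W] order_trans[OF length_prune[of B z W]] unfolding entry_bounded_def
  by auto

lemma size_enc_expand:
  assumes m: "\<And>t u v. size (enc (m t u v)) \<le> b" and ts: "\<And>t. t \<in> set ts \<Longrightarrow> size (enc t) \<le> b"
    and p: "p \<in> set (expand m i X j Y ts)"
  shows "size (enc (fst p)) \<le> b \<and> size (enc (snd p)) \<le> b"
proof -
  from p obtain t u v w where "t \<in> set ts" "p = (t, m u v w)"
    unfolding set_expand by auto
  with m ts show ?thesis by simp
qed

text \<open>Bounding lengths and assignments separately gives the same \<open>b\<close> before and
  after the step: assignments are old ones or outputs of \<open>m\<close>, and pruning caps the new
  lists. Hence repetition causes no growth.\<close>

lemma state_bounded_swap_step:
  assumes m: "\<And>t u v. size (enc (m t u v)) \<le> b" and B: "length B * length B \<le> b"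
    and e: "entry_bounded b e" and S: "state_bounded b S"
  shows "state_bounded b (swap_step m B z e S)"
proof (cases "z \<in> set (map fst S)")
  case True
  let ?Z = "lookup [] S z"
  have Z: "size (enc t) \<le> b" if "t \<in> set (map fst ?Z)" for t
  proof -
    from that obtain p where "t = fst p" "p \<in> set ?Z" by auto
    with lookup_in_state[of p S z] S show ?thesis
      unfolding state_bounded_def entry_bounded_def by auto
  qed
  have E: "size (enc t) \<le> b" if "t \<in> set (map fst (snd e))" for t
    using that e unfolding entry_bounded_def by auto
  have "entry_bounded b (z, prune B z (expand m (fst e) (snd e) z ?Z (map fst ?Z)))"
  proof (rule entry_bounded_prune[OF B])
    show "size (enc z) \<le> b"
      using True S unfolding state_bounded_def entry_bounded_def by auto
    show "size (enc (fst p)) \<le> b \<and> size (enc (snd p)) \<le> b"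
      if "p \<in> set (expand m (fst e) (snd e) z ?Z (map fst ?Z))" for p
      using m Z that by (rule size_enc_expand)
  qed
  moreover have "entry_bounded b (fst e, prune B (fst e) (filter (\<lambda>(t, t'). val t z = val t' z)
      (expand m (fst e) (snd e) z ?Z (map fst (snd e)))))"
  proof (rule entry_bounded_prune[OF B])
    show "size (enc (fst e)) \<le> b" using e unfolding entry_bounded_def by simp
    fix p assume "p \<in> set (filter (\<lambda>(t, t'). val t z = val t' z)
      (expand m (fst e) (snd e) z ?Z (map fst (snd e))))"
    then have "p \<in> set (expand m (fst e) (snd e) z ?Z (map fst (snd e)))" by simp
    with m E show "size (enc (fst p)) \<le> b \<and> size (enc (snd p)) \<le> b"
      by (rule size_enc_expand)
  qed
  moreover have "state_bounded b (tl S)" using S by (cases S) auto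
  ultimately show ?thesis
    unfolding swap_step_def if_P[OF True] by simp
next
  case False
  with e S show ?thesis by (simp add: swap_step_def)
qed

lemma state_bounded_foldr_swap_step:
  assumes "\<And>t u v. size (enc (m t u v)) \<le> b" "length B * length B \<le> b" "state_bounded b S"
  shows "state_bounded b (foldr (swap_step m B z) S [])"
  using assms(3)
proof (induction S)
  case (Cons e S)
  with state_bounded_swap_step[OF assms(1,2)] show ?case by simp
qed simp

lemma enc_0: "enc (0 :: nat) = Dnil"
  by (simp add: enc_nat_def nat_code.simps[of 0])

definition maltsev_bound :: "(nat \<times> nat list \<times> nat) list \<Rightarrow> nat list \<Rightarrow> nat" where
  "maltsev_bound T V = length V * (size (enc V) + size (enc T) + 2)"

text \<open>Vertices come from \<open>V\<close> and values from \<open>T\<close>, or are 0, whose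
  code is \<open>Dnil\<close>. So the bound is independent of the sizes of the three arguments, and
  nested applications of \<open>m\<close> do not blow up.\<close>

lemma size_enc_maltsev: "size (enc (maltsev k T V t u v)) \<le> maltsev_bound T V"
proof -
  have *: "size (enc (lookup 0 (map (\<lambda>(y, as, c). ((y, as), c)) T) p)) \<le> size (enc T)" for p
    by (induction T) (simp_all add: enc_0 case_prod_beta enc_prod_def pair_code_def)
  have "size (enc p) \<le> size (enc V) + size (enc T) + 1" if "p \<in> set (maltsev k T V t u v)" for p
  proof -
    from that obtain x q where "x \<in> set V"
      "p = (x, lookup 0 (map (\<lambda>(y, as, c). ((y, as), c)) T) q)"
      unfolding maltsev_def set_map by blast
    with size_enc_member[of x V] *[of q] show ?thesis by simp
  qed
  then have "size (enc (maltsev k T V t u v)) \<le> length (maltsev k T V t u v) * (size (enc V) + size (enc T) + 1 + 1)"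
    by (rule size_enc_list_le)
  then show ?thesis
    unfolding maltsev_bound_def by (simp add: maltsev_def del: size_enc_append)
qed

lemma feasible_bring [feas]:
  assumes "feasible E T" "feasible E V" "feasible E z" "feasible E S"
  shows "feasible E (\<lambda>s. bring (maltsev k (T s) (V s)) B (z s) (S s))"
  unfolding bring_def
proof (rule feasible_foldr)
  \<comment> \<open>The summands cover the three sources of size: outputs of \<open>maltsev\<close>,
    pruned lists and the given state.\<close>
  let ?b = "\<lambda>s. maltsev_bound (T s) (V s) + length B * length B + size (enc (S s))"
  show "poly_bounded E (\<lambda>s. length (S s) * (?b s + ?b s * (2 * ?b s + 2) + 2))"
    unfolding maltsev_bound_def by (intro bounds assms)
  fix s ys assume ys: "suffix ys (S s)"
  let ?S = "foldr (swap_step (maltsev k (T s) (V s)) B (z s)) ys []"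
  have "state_bounded (?b s) ys"
    by (rule state_bounded_self[OF _ set_mono_suffix[OF ys]]) simp
  then have "state_bounded (?b s) ?S"
    by (intro state_bounded_foldr_swap_step) (auto intro: order_trans[OF size_enc_maltsev])
  from state_bounded_size_enc[OF this] suffix_length_le[OF ys]
  show "size (enc ?S) \<le> length (S s) * (?b s + ?b s * (2 * ?b s + 2) + 2)"
    unfolding length_foldr_swap_step by (meson mult_le_mono1 order_trans)
qed (intro feas assms feasible_outer)+

section \<open>Imposing one arc on a state\<close>

definition candidates ::
  "(assignment \<Rightarrow> assignment \<Rightarrow> assignment \<Rightarrow> assignment) \<Rightarrow> nat list \<Rightarrow> (nat \<times> nat) list \<Rightarrow>
   nat \<times> nat \<Rightarrow> nat \<Rightarrow> state \<Rightarrow> assignment list" where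
  "candidates m B A a z S = map snd (filter (\<lambda>p. (val (snd p) (fst a), val (snd p) (snd a)) \<in> set A)
     (expand m (fst a) (lookup [] (bring m B z S) (fst a)) (snd a) (lookup [] (bring m B z S) (snd a))
        (map fst (lookup [] (bring m B z S) z))))"

lemma feasible_candidates [feas]:
  assumes "feasible E T" "feasible E V" "feasible E a" "feasible E z" "feasible E S"
  shows "feasible E (\<lambda>s. candidates (maltsev k (T s) (V s)) B A (a s) (z s) (S s))"
  unfolding candidates_def by (intro feas assms feasible_outer)

text \<open>The ends of \<open>a\<close> are expected at the head of \<open>S\<close>. At the first
  end any two candidates may be paired, at the second end those that agree at the first. At a later
  \<open>z\<close> a candidate is exchanged along a stored pair; this leaves both ends unchanged and
  so respects the new constraint.\<close>

definition restrict_entry ::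
  "(assignment \<Rightarrow> assignment \<Rightarrow> assignment \<Rightarrow> assignment) \<Rightarrow> nat list \<Rightarrow> (nat \<times> nat) list \<Rightarrow>
   nat \<times> nat \<Rightarrow> state \<Rightarrow> nat \<Rightarrow> (assignment \<times> assignment) list \<Rightarrow> (assignment \<times> assignment) list" where
  "restrict_entry m B A a S z W =
     (if z = fst a then List.product (candidates m B A a (fst a) S) (candidates m B A a (fst a) S)
      else if z = snd a
      then filter (\<lambda>p. val (fst p) (fst a) = val (snd p) (fst a))
        (List.product (candidates m B A a (fst a) S) (candidates m B A a (fst a) S))
      else concat (map (\<lambda>t. map (\<lambda>p. (t, m t (fst p) (snd p))) (filter (\<lambda>p. val (fst p) z = val t z) W))
        (candidates m B A a z S)))"

lemma feasible_restrict_entry [feas]: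
  assumes "feasible E T" "feasible E V" "feasible E a" "feasible E S" "feasible E z" "feasible E W"
  shows "feasible E (\<lambda>s. restrict_entry (maltsev k (T s) (V s)) B A (a s) (S s) (z s) (W s))"
  unfolding restrict_entry_def by (intro feas assms feasible_outer)

text \<open>Bringing \<open>snd a\<close> to the front before \<open>fst a\<close> leaves it
  directly behind \<open>fst a\<close>, unless the arc is a loop and both are the same
  variable.\<close>

definition restrict_state ::
  "(assignment \<Rightarrow> assignment \<Rightarrow> assignment \<Rightarrow> assignment) \<Rightarrow> nat list \<Rightarrow> (nat \<times> nat) list \<Rightarrow>
   nat \<times> nat \<Rightarrow> state \<Rightarrow> state" where
  "restrict_state m B A a S = map (\<lambda>e. (fst e, prune B (fst e)
     (restrict_entry m B A a (bring m B (fst a) (bring m B (snd a) S)) (fst e) (snd e))))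
       (bring m B (fst a) (bring m B (snd a) S))"

lemma feasible_restrict_state [feas]:
  assumes "feasible E T" "feasible E V" "feasible E a" "feasible E S"
  shows "feasible E (\<lambda>s. restrict_state (maltsev k (T s) (V s)) B A (a s) (S s))"
  unfolding restrict_state_def by (intro feas assms feasible_outer)

lemma length_restrict: "length (restrict_state m B A a S) = length S"
  by (simp add: restrict_state_def bring_def length_foldr_swap_step)

lemma state_bounded_restrict:
  assumes m: "\<And>t u v. size (enc (m t u v)) \<le> b" and B: "length B * length B \<le> b"
    and S: "state_bounded b S"
  shows "state_bounded b (restrict_state m B A a S)"
proof -
  let ?S = "bring m B (fst a) (bring m B (snd a) S)"
  have S': "state_bounded b ?S"
    unfolding bring_def by (intro state_bounded_foldr_swap_step m B S)
  have cand: "size (enc t) \<le> b" if "t \<in> set (candidates m B A a z S)" for t z S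
  proof -
    from that have "\<exists>u v w. t = m u v w"
      unfolding candidates_def set_map set_filter image_iff mem_Collect_eq set_expand by fastforce
    with m show ?thesis by auto
  qed
  have "size (enc (fst p)) \<le> b \<and> size (enc (snd p)) \<le> b"
    if "p \<in> set (restrict_entry m B A a S z W)" for p S z W
    using that m cand unfolding restrict_entry_def by (auto split: if_splits)
  then have "entry_bounded b (fst e, prune B (fst e) (restrict_entry m B A a ?S (fst e) (snd e)))"
    if "e \<in> set ?S" for e
    using that S' unfolding state_bounded_def
    by (intro entry_bounded_prune[OF B]) (auto simp: entry_bounded_def)
  then show ?thesis
    unfolding restrict_state_def state_bounded_def by auto
qed

section \<open>The initial state and the decision procedure\<close>

definition start :: "nat list \<Rightarrow> (nat \<times> nat) list \<Rightarrow> nat \<Rightarrow> nat \<Rightarrow> assignment" where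
  "start V L x a = map (\<lambda>y. (y, if y = x then a else lookup 0 L y)) V"

definition values_at :: "(nat \<times> nat) list \<Rightarrow> nat \<Rightarrow> nat list" where
  "values_at L x = map snd (filter (\<lambda>p. fst p = x) L)"

text \<open>Before any arc is imposed the relation is the product of the lists. Two assignments
  \<open>start V L x a\<close> and \<open>start V L x b\<close> differ at most at \<open>x\<close>,
  so they form a witness pair whatever the earlier variables are.\<close>

definition init :: "nat list \<Rightarrow> (nat \<times> nat) list \<Rightarrow> state" where
  "init V L = map (\<lambda>x. (x, map (\<lambda>p. (start V L x (fst p), start V L x (snd p)))
     (List.product (values_at L x) (values_at L x)))) V"

lemma feasible_init [feas]:
  assumes "feasible E V" "feasible E L"
  shows "feasible E (\<lambda>s. init (V s) (L s))"
  unfolding init_def start_def values_at_def by (intro feas assms feasible_outer)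

text \<open>Nonemptiness of the lists is tested first, because \<open>start\<close> takes its
  default value at each vertex from them.\<close>

definition decide ::
  "nat \<Rightarrow> nat list \<Rightarrow> (nat \<times> nat) list \<Rightarrow> nat list \<Rightarrow> (nat \<times> nat) list \<Rightarrow> (nat \<times> nat) list \<Rightarrow>
   (nat \<times> nat list \<times> nat) list \<Rightarrow> bool" where
  "decide k B H V A L T \<longleftrightarrow> (\<forall>x \<in> set V. x \<in> set (map fst L)) \<and>
     (\<forall>e \<in> set (foldr (restrict_state (maltsev k T V) B H) A (init V L)). \<not> snd e = [])"

text \<open>By \<open>state_bounded_restrict\<close> one bound survives every arc and
  \<open>length_restrict\<close> fixes the number of entries, so the size of the state does not
  depend on how many arcs have been imposed.\<close>

lemma feasible_foldr_restrict [feas]: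
  assumes "feasible E V" "feasible E A" "feasible E S" "feasible E T"
  shows "feasible E (\<lambda>s. foldr (restrict_state (maltsev k (T s) (V s)) B H) (A s) (S s))"
proof (rule feasible_foldr)
  let ?b = "\<lambda>s. maltsev_bound (T s) (V s) + length B * length B + size (enc (S s))"
  show "poly_bounded E (\<lambda>s. length (S s) * (?b s + ?b s * (2 * ?b s + 2) + 2))"
    unfolding maltsev_bound_def by (intro bounds assms)
  fix s ys
  let ?S = "foldr (restrict_state (maltsev k (T s) (V s)) B H) ys (S s)"
  have "state_bounded (?b s) ?S \<and> length ?S = length (S s)"
  proof (induction ys)
    case Nil
    show ?case by (simp add: state_bounded_self[OF _ subset_refl])
  next
    case (Cons a ys)
    then show ?case
      by (auto simp: length_restrict intro!: state_bounded_restrict order_trans[OF size_enc_maltsev])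
  qed
  then show "size (enc ?S) \<le> length (S s) * (?b s + ?b s * (2 * ?b s + 2) + 2)"
    using state_bounded_size_enc by metis
qed (intro feas assms feasible_outer)+

lemma feasible_decide [feas]:
  assumes "feasible E V" "feasible E A" "feasible E L" "feasible E T"
  shows "feasible E (\<lambda>s. decide k B H (V s) (A s) (L s) (T s))"
  unfolding decide_def by (intro feas assms feasible_outer)

section \<open>Correctness\<close>

definition agree :: "nat set \<Rightarrow> assignment \<Rightarrow> assignment \<Rightarrow> bool" where
  "agree S t u \<longleftrightarrow> (\<forall>x \<in> S. val t x = val u x)"

text \<open>One entry of a compact representation, with \<open>S\<close> the set of earlier
  variables; \<open>represents\<close> lets this set grow along the state. Only the values at
  \<open>z\<close> of a pair of members are matched, not the members themselves.\<close>

definition witnesses :: "assignment set \<Rightarrow> nat set \<Rightarrow> nat \<Rightarrow> (assignment \<times> assignment) list \<Rightarrow> bool" where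
  "witnesses R S z W \<longleftrightarrow>
     (\<forall>p \<in> set W. fst p \<in> R \<and> snd p \<in> R \<and> agree S (fst p) (snd p)) \<and>
     (\<forall>t \<in> R. \<forall>u \<in> R. agree S t u \<longrightarrow> (\<exists>p \<in> set W. val (fst p) z = val t z \<and> val (snd p) z = val u z))"

lemma witnessesI:
  assumes "\<And>p. p \<in> set W \<Longrightarrow> fst p \<in> R \<and> snd p \<in> R \<and> agree S (fst p) (snd p)"
    and "\<And>t u. t \<in> R \<Longrightarrow> u \<in> R \<Longrightarrow> agree S t u \<Longrightarrow> \<exists>p \<in> set W. val (fst p) z = val t z \<and> val (snd p) z = val u z"
  shows "witnesses R S z W"
  using assms unfolding witnesses_def by blast

lemma witnessesD1:
  "witnesses R S z W \<Longrightarrow> p \<in> set W \<Longrightarrow> fst p \<in> R"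
  "witnesses R S z W \<Longrightarrow> p \<in> set W \<Longrightarrow> snd p \<in> R"
  "witnesses R S z W \<Longrightarrow> p \<in> set W \<Longrightarrow> agree S (fst p) (snd p)"
  unfolding witnesses_def by blast+

lemma witnessesD2:
  assumes "witnesses R S z W" "t \<in> R" "u \<in> R" "agree S t u"
  obtains p where "p \<in> set W" "val (fst p) z = val t z" "val (snd p) z = val u z"
  using assms unfolding witnesses_def by blast

lemma agree_refl [simp]: "agree S t t"
  by (simp add: agree_def)

lemma witnesses_value:
  assumes "witnesses R S z W" "t \<in> R"
  obtains p where "p \<in> set W" "val (fst p) z = val t z"
  using witnessesD2[OF assms(1,2,2) agree_refl] by blast

lemma find_pair_exists:
  "p \<in> set W \<Longrightarrow> \<exists>q \<in> set (find_pair z (val (fst p) z, val (snd p) z) W).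
     val (fst q) z = val (fst p) z \<and> val (snd q) z = val (snd p) z"
  by (induction W) auto

text \<open>Pruning searches value pairs over \<open>B\<close> only, so all values at
  \<open>z\<close> must lie in \<open>B\<close>. For solutions this holds since every list is
  contained in the vertex set of \<open>H\<close>.\<close>

lemma witnesses_prune:
  assumes W: "witnesses R S z W" and B: "\<And>t. t \<in> R \<Longrightarrow> val t z \<in> set B"
  shows "witnesses R S z (prune B z W)"
proof (rule witnessesI)
  show "fst p \<in> R \<and> snd p \<in> R \<and> agree S (fst p) (snd p)" if "p \<in> set (prune B z W)" for p
    using that set_prune[of B z W] witnessesD1[OF W] by blast
  fix t u assume "t \<in> R" "u \<in> R" "agree S t u"
  with W obtain p where p: "p \<in> set W" "val (fst p) z = val t z" "val (snd p) z = val u z"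
    by (rule witnessesD2)
  from find_pair_exists[OF p(1), of z] obtain q where q: "q \<in> set (find_pair z (val t z, val u z) W)"
    "val (fst q) z = val t z" "val (snd q) z = val u z"
    unfolding p by blast
  moreover have "(val t z, val u z) \<in> set (List.product B B)"
    using B \<open>t \<in> R\<close> \<open>u \<in> R\<close> by simp
  ultimately have "q \<in> set (prune B z W)" unfolding prune_def by auto
  with q show "\<exists>p \<in> set (prune B z W). val (fst p) z = val t z \<and> val (snd p) z = val u z" by blast
qed

primrec represents :: "assignment set \<Rightarrow> nat set \<Rightarrow> state \<Rightarrow> bool" where
  "represents R S [] \<longleftrightarrow> True"
| "represents R S (e # es) \<longleftrightarrow> witnesses R S (fst e) (snd e) \<and> represents R (insert (fst e) S) es"

text \<open>The Maltsev identities m(a, b, b) = a and m(a, a, c) = c are required at each variable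
  separately, and for members of \<open>R\<close> only. The assumption \<open>val_in\<close> serves
  pruning.\<close>

locale maltsev_relation =
  fixes m :: "assignment \<Rightarrow> assignment \<Rightarrow> assignment \<Rightarrow> assignment"
    and R :: "assignment set" and V :: "nat set" and B :: "nat list"
  assumes closed: "t \<in> R \<Longrightarrow> u \<in> R \<Longrightarrow> v \<in> R \<Longrightarrow> m t u v \<in> R"
    and cancel_right: "t \<in> R \<Longrightarrow> u \<in> R \<Longrightarrow> v \<in> R \<Longrightarrow> val u x = val v x \<Longrightarrow> val (m t u v) x = val t x"
    and cancel_left: "t \<in> R \<Longrightarrow> u \<in> R \<Longrightarrow> v \<in> R \<Longrightarrow> val t x = val u x \<Longrightarrow> val (m t u v) x = val v x"
    and val_in: "t \<in> R \<Longrightarrow> x \<in> V \<Longrightarrow> val t x \<in> set B"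
begin

text \<open>Where \<open>u\<close> and \<open>v\<close> coincide, m(t, u, v) keeps the value of
  \<open>t\<close>. Thus the change from \<open>u\<close> to \<open>v\<close> is carried over to
  \<open>t\<close> without touching \<open>S\<close>.\<close>

lemma agree_transfer:
  assumes "t \<in> R" "u \<in> R" "v \<in> R" "agree S u v"
  shows "agree S t (m t u v)"
  using assms cancel_right unfolding agree_def by simp

text \<open>The alternative \<open>i = j\<close> with \<open>S' = S\<close> is the case of a loop
  arc, where both exchange steps act on the same variable and use the same earlier
  variables.\<close>

lemma expand_sound:
  assumes X: "witnesses R S i X" and Y: "witnesses R S' j Y" and S: "S' = insert i S \<or> i = j \<and> S' = S"
    and ts: "set ts \<subseteq> R" and r: "r \<in> set (expand m i X j Y ts)"
  shows "fst r \<in> set ts" "fst r \<in> R" "snd r \<in> R" "agree S (fst r) (snd r)"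
proof -
  from r obtain t p q where t: "t \<in> set ts" and p: "p \<in> set X" and q: "q \<in> set Y"
    and r: "r = (t, m (m t (fst p) (snd p)) (fst q) (snd q))"
    unfolding set_expand by blast
  let ?s = "m t (fst p) (snd p)"
  have R: "t \<in> R" "fst p \<in> R" "snd p \<in> R" "fst q \<in> R" "snd q \<in> R"
    using t ts witnessesD1[OF X p] witnessesD1[OF Y q] by auto
  have s: "?s \<in> R" using R by (simp add: closed)
  have "agree S t ?s"
    by (rule agree_transfer[OF R(1-3) witnessesD1(3)[OF X p]])
  moreover have "agree S' ?s (m ?s (fst q) (snd q))"
    by (rule agree_transfer[OF s R(4,5) witnessesD1(3)[OF Y q]])
  ultimately show "agree S (fst r) (snd r)"
    using S unfolding r agree_def by auto
  show "fst r \<in> set ts" "fst r \<in> R" "snd r \<in> R" using r t R s closed by auto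
qed

text \<open>The first exchange gives \<open>t\<close> the value of \<open>u\<close> at
  \<open>i\<close>. The result agrees with \<open>u\<close> on \<open>S'\<close>, so a stored pair
  for \<open>j\<close> applies, and the second exchange then reaches the value of \<open>u\<close>
  at \<open>j\<close>.\<close>

lemma expand_complete:
  assumes X: "witnesses R S i X" and Y: "witnesses R S' j Y" and S: "S' = insert i S \<or> i = j \<and> S' = S"
    and t: "t \<in> set ts" "t \<in> R" and u: "u \<in> R" "agree S t u"
  shows "\<exists>s. (t, s) \<in> set (expand m i X j Y ts) \<and> val s i = val u i \<and> val s j = val u j"
proof -
  obtain p where p: "p \<in> set X" "val (fst p) i = val t i" "val (snd p) i = val u i"
    using witnessesD2[OF X t(2) u] by blast
  let ?s = "m t (fst p) (snd p)"
  have pR: "fst p \<in> R" "snd p \<in> R" using witnessesD1[OF X p(1)] by auto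
  have s: "?s \<in> R" using t pR by (simp add: closed)
  have si: "val ?s i = val u i"
    using cancel_left[OF t(2) pR] p by simp
  moreover have "agree S t ?s"
    by (rule agree_transfer[OF t(2) pR witnessesD1(3)[OF X p(1)]])
  ultimately have "agree S' ?s u" using S u unfolding agree_def by auto
  then obtain q where q: "q \<in> set Y" "val (fst q) j = val ?s j" "val (snd q) j = val u j"
    using witnessesD2[OF Y s u(1)] by blast
  have qR: "fst q \<in> R" "snd q \<in> R" using witnessesD1[OF Y q(1)] by auto
  let ?s' = "m ?s (fst q) (snd q)"
  have sj: "val ?s' j = val u j"
    using cancel_left[OF s qR] q by simp
  have "val ?s' i = val u i"
  \<comment> \<open>For distinct variables \<open>i\<close> belongs to \<open>S'\<close>, so the
    second exchange leaves the value at \<open>i\<close> alone.\<close>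
  proof (cases "i = j")
    case False
    with S have "i \<in> S'" by blast
    with agree_transfer[OF s qR witnessesD1(3)[OF Y q(1)]] si show ?thesis
      unfolding agree_def by auto
  qed (use sj in simp)
  moreover have "(t, ?s') \<in> set (expand m i X j Y ts)"
    unfolding set_expand using t(1) p q by blast
  ultimately show ?thesis using sj by blast
qed

text \<open>Expanding only from stored first components suffices: choose a stored \<open>w\<close>
  with the value of \<open>t\<close> at \<open>z\<close> and replace (t, u) by (w, m(w, t, u)). The
  new pair has the same values at \<open>z\<close> and agrees on \<open>S\<close>.\<close>

lemma witnesses_swap_first:
  assumes y: "witnesses R S y X" and z: "witnesses R (insert y S) z Z"
  shows "witnesses R S z (expand m y X z Z (map fst Z))"
proof (rule witnessesI)
  have Z: "set (map fst Z) \<subseteq> R" using witnessesD1[OF z] by auto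
  show "fst r \<in> R \<and> snd r \<in> R \<and> agree S (fst r) (snd r)" if "r \<in> set (expand m y X z Z (map fst Z))" for r
    using expand_sound[OF y z _ Z that] by blast
  fix t u assume tu: "t \<in> R" "u \<in> R" "agree S t u"
  obtain p where p: "p \<in> set Z" "val (fst p) z = val t z"
    using witnesses_value[OF z tu(1)] by blast
  have w: "fst p \<in> R" using witnessesD1[OF z p(1)] by simp
  let ?u = "m (fst p) t u"
  have u: "?u \<in> R" "agree S (fst p) ?u" "val ?u z = val u z"
    using tu w p by (simp_all add: closed agree_transfer cancel_left)
  obtain s where "(fst p, s) \<in> set (expand m y X z Z (map fst Z))" "val s z = val ?u z"
    using expand_complete[OF y z _ _ w u(1,2), of "map fst Z"] p(1) by auto
  with p u show "\<exists>p \<in> set (expand m y X z Z (map fst Z)). val (fst p) z = val t z \<and> val (snd p) z = val u z"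
    by (intro bexI[of _ "(fst p, s)"]) simp_all
qed

text \<open>The replacement is the same with \<open>w\<close> matching \<open>t\<close> at
  \<open>y\<close>. Now \<open>z\<close> counts as an earlier variable: the filter enforces
  agreement there, and m(w, t, u) agrees with \<open>w\<close> at \<open>z\<close> because
  \<open>t\<close> and \<open>u\<close> agree at \<open>z\<close>.\<close>

lemma witnesses_swap_second:
  assumes y: "witnesses R S y X" and z: "witnesses R (insert y S) z Z"
  shows "witnesses R (insert z S) y (filter (\<lambda>(t, t'). val t z = val t' z) (expand m y X z Z (map fst X)))"
proof (rule witnessesI)
  have X: "set (map fst X) \<subseteq> R" using witnessesD1[OF y] by auto
  show "fst r \<in> R \<and> snd r \<in> R \<and> agree (insert z S) (fst r) (snd r)"
    if "r \<in> set (filter (\<lambda>(t, t'). val t z = val t' z) (expand m y X z Z (map fst X)))" for r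
    using expand_sound[OF y z _ X, of r] that by (auto simp: agree_def)
  fix t u assume tu: "t \<in> R" "u \<in> R" "agree (insert z S) t u"
  obtain p where p: "p \<in> set X" "val (fst p) y = val t y"
    using witnesses_value[OF y tu(1)] by blast
  have w: "fst p \<in> R" using witnessesD1[OF y p(1)] by simp
  let ?u = "m (fst p) t u"
  have u: "?u \<in> R" "agree (insert z S) (fst p) ?u" "val ?u y = val u y"
    using tu w p by (simp_all add: closed agree_transfer cancel_left)
  then have "agree S (fst p) ?u" "val (fst p) z = val ?u z" by (auto simp: agree_def)
  moreover obtain s where "(fst p, s) \<in> set (expand m y X z Z (map fst X))" "val s y = val ?u y"
    "val s z = val ?u z"
    using expand_complete[OF y z _ _ w u(1), of "map fst X"] calculation(1) p(1) by auto
  ultimately show "\<exists>p \<in> set (filter (\<lambda>(t, t'). val t z = val t' z) (expand m y X z Z (map fst X))).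
      val (fst p) y = val t y \<and> val (snd p) y = val u y"
    using p u by force
qed

lemma bring_absent: "z \<notin> set (map fst es) \<Longrightarrow> bring m B z es = es"
  unfolding bring_def by (induction es) (simp_all add: swap_step_def)

text \<open>By induction \<open>z\<close> already heads the remaining entries when \<open>e\<close>
  is reached, so the step at \<open>e\<close> is a single transposition of adjacent variables,
  settled by the two swap lemmas and pruning.\<close>

lemma represents_bring:
  assumes "represents R S es" "distinct (map fst es)" "set (map fst es) \<subseteq> V" "z \<in> set (map fst es)"
  shows "represents R S (bring m B z es) \<and> map fst (bring m B z es) = z # remove1 z (map fst es)"
  using assms
proof (induction es arbitrary: S)
  case (Cons e es)
  show ?case
  proof (cases "fst e = z")
    case True
    \<comment> \<open>By distinctness \<open>z\<close> does not occur behind \<open>e\<close>, so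
      all steps so far, and the one at \<open>e\<close>, merely copy entries.\<close>
    with Cons.prems bring_absent[of z "e # es"] bring_absent[of z es] show ?thesis
      by (auto simp: bring_def swap_step_def)
  next
    case False
    with Cons.prems Cons.IH[of "insert (fst e) S"]
    have IH: "represents R (insert (fst e) S) (bring m B z es)"
      "map fst (bring m B z es) = z # remove1 z (map fst es)"
      by auto
    then obtain Z rest where b: "bring m B z es = (z, Z) # rest" "map fst rest = remove1 z (map fst es)"
      by (cases "bring m B z es") auto
    have y: "witnesses R S (fst e) (snd e)" using Cons.prems by simp
    have z: "witnesses R (insert (fst e) S) z Z" and rest: "represents R (insert z (insert (fst e) S)) rest"
      using IH(1) b by auto
    have V: "fst e \<in> V" "z \<in> V" using Cons.prems by auto
    have step: "bring m B z (e # es) = (z, prune B z (expand m (fst e) (snd e) z Z (map fst Z))) #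
       (fst e, prune B (fst e) (filter (\<lambda>(t, t'). val t z = val t' z)
          (expand m (fst e) (snd e) z Z (map fst (snd e))))) # rest"
      using b by (simp add: bring_def swap_step_def)
    show ?thesis
      unfolding step using witnesses_prune[OF witnesses_swap_first[OF y z]]
        witnesses_prune[OF witnesses_swap_second[OF y z]] rest b(2) val_in V False
      by (simp add: insert_commute)
  qed
qed simp

end

lemma witnesses_lookup:
  assumes "represents R S es" "distinct (map fst es)" "map fst es = zs @ z # zs'"
  shows "witnesses R (S \<union> set zs) z (lookup [] es z)"
  using assms
proof (induction es arbitrary: S zs)
  case (Cons e es)
  show ?case
  proof (cases zs)
    case Nil
    with Cons.prems show ?thesis by auto
  next
    case zs: (Cons y ys)
    with Cons.prems(3) have es: "fst e = y" "map fst es = ys @ z # zs'" by auto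
    then have "z \<in> set (map fst es)" by (metis in_set_conv_decomp)
    with Cons.prems(2) have "fst e \<noteq> z" by auto
    with es Cons.prems zs Cons.IH[of "insert y S" ys] show ?thesis by auto
  qed
qed simp

section \<open>Imposing a binary constraint on the first two variables\<close>

context maltsev_relation
begin

context
  fixes A :: "(nat \<times> nat) list" and x y :: nat and R' :: "assignment set" and S :: state and zs :: "nat list"
  defines "R' \<equiv> {t \<in> R. (val t x, val t y) \<in> set A}"
  assumes xy: "x \<in> V" "y \<in> V"
    and S: "represents R {} S" "distinct (map fst S)" "set (map fst S) = V"
    and front: "map fst S = x # zs" "x \<noteq> y \<Longrightarrow> hd zs = y"
begin

text \<open>The value of \<open>hd\<close> says nothing about an empty list; that \<open>zs\<close>
  is nonempty comes from \<open>y \<in> V\<close> and \<open>x \<noteq> y\<close>.\<close>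

lemma zs_Cons: "x \<noteq> y \<Longrightarrow> zs = y # tl zs"
  using front xy S(3) by (cases zs) auto

text \<open>\<open>X\<close> is the set of variables before \<open>x\<close> once \<open>z\<close>
  has been moved to the front: empty for \<open>z = x\<close>, otherwise \<open>{z}\<close>. For
  \<open>z = y \<noteq> x\<close> the order of \<open>x\<close> and \<open>y\<close> would be
  reversed, and \<open>restrict_entry\<close> never asks for this case.\<close>

lemma bring_front:
  assumes "z \<in> V" "z = x \<or> z \<noteq> y"
  obtains X where
    "witnesses R {} z (lookup [] (bring m B z S) z)"
    "witnesses R X x (lookup [] (bring m B z S) x)"
    "witnesses R (if x = y then X else insert x X) y (lookup [] (bring m B z S) y)"
    "X \<subseteq> {z}" "z \<noteq> x \<Longrightarrow> z \<in> X"
proof -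
  let ?S = "bring m B z S"
  have S': "represents R {} ?S" "map fst ?S = z # remove1 z (x # zs)"
    using represents_bring[OF S(1,2), of z] S(3) assms(1) unfolding front(1)[symmetric] by auto
  have d: "distinct (map fst ?S)" using S' S(2) front(1) by auto
  note w = witnesses_lookup[OF S'(1) d]
  show thesis
  proof (cases "z = x")
    case True
    have "witnesses R ({} \<union> set []) z (lookup [] ?S z)" "witnesses R ({} \<union> set []) x (lookup [] ?S x)"
      using S'(2) True by (intro w; simp)+
    moreover have "witnesses R (if x = y then {} else insert x {}) y (lookup [] ?S y)"
    proof (cases "x = y")
      case False
      have "witnesses R ({} \<union> set [x]) y (lookup [] ?S y)"
        using S'(2) True zs_Cons[OF False] by (intro w[where zs' = "tl zs"]) simp
      with False show ?thesis by simp
    qed (use calculation in simp)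
    ultimately show thesis using that[of "{}"] True by simp
  next
    case False
    then have z: "map fst ?S = [z] @ x # remove1 z zs" using S'(2) by simp
    have "witnesses R ({} \<union> set []) z (lookup [] ?S z)" "witnesses R ({} \<union> set [z]) x (lookup [] ?S x)"
      using z by (intro w; simp)+
    moreover have "witnesses R (if x = y then {z} else insert x {z}) y (lookup [] ?S y)"
    proof (cases "x = y")
      case xy: False
      have "remove1 z zs = y # remove1 z (tl zs)"
        using False assms(2) by (subst zs_Cons[OF xy]) simp
      with z have "witnesses R ({} \<union> set [z, x]) y (lookup [] ?S y)"
        by (intro w[where zs' = "remove1 z (tl zs)"]) simp
      with xy show ?thesis by (simp add: insert_commute)
    qed (use calculation in simp)
    ultimately show thesis using that[of "{z}"] False by simp
  qed
qed

lemma candidates_sound: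
  assumes "z \<in> V" "z = x \<or> z \<noteq> y"
  shows "set (candidates m B A (x, y) z S) \<subseteq> R'"
proof -
  obtain X where X: "witnesses R {} z (lookup [] (bring m B z S) z)"
    "witnesses R X x (lookup [] (bring m B z S) x)"
    "witnesses R (if x = y then X else insert x X) y (lookup [] (bring m B z S) y)"
    using bring_front[OF assms] by blast
  have "set (map fst (lookup [] (bring m B z S) z)) \<subseteq> R" using witnessesD1[OF X(1)] by auto
  from expand_sound(3)[OF X(2,3) _ this] show ?thesis
    unfolding candidates_def R'_def by auto
qed

text \<open>Start from a stored \<open>w\<close> with the value of \<open>t\<close> at
  \<open>z\<close>. It agrees with \<open>t\<close> on \<open>X\<close>, so expansion reaches the
  values of \<open>t\<close> at \<open>x\<close> and \<open>y\<close>; the value at \<open>z\<close>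
  survives because \<open>z\<close> is in \<open>X\<close> or equals \<open>x\<close>.\<close>

lemma candidates_complete:
  assumes "z \<in> V" "z = x \<or> z \<noteq> y" and t: "t \<in> R'"
  obtains c where "c \<in> set (candidates m B A (x, y) z S)" "val c x = val t x" "val c y = val t y" "val c z = val t z"
proof -
  obtain X where X: "witnesses R {} z (lookup [] (bring m B z S) z)"
    "witnesses R X x (lookup [] (bring m B z S) x)"
    "witnesses R (if x = y then X else insert x X) y (lookup [] (bring m B z S) y)"
    "X \<subseteq> {z}" "z \<noteq> x \<Longrightarrow> z \<in> X"
    using bring_front[OF assms(1,2)] by blast
  have R: "t \<in> R" "(val t x, val t y) \<in> set A" using t unfolding R'_def by auto
  let ?ts = "map fst (lookup [] (bring m B z S) z)"
  have ts: "set ?ts \<subseteq> R" using witnessesD1[OF X(1)] by auto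
  obtain p where p: "p \<in> set (lookup [] (bring m B z S) z)" "val (fst p) z = val t z"
    using witnesses_value[OF X(1) R(1)] by blast
  have w: "fst p \<in> set ?ts" "fst p \<in> R" using p(1) ts by auto
  have "agree X (fst p) t" using X(4) p(2) by (auto simp: agree_def)
  moreover have "(if x = y then X else insert x X) = insert x X \<or> x = y \<and> (if x = y then X else insert x X) = X"
    by simp
  ultimately obtain s where s: "(fst p, s) \<in> set (expand m x (lookup [] (bring m B z S) x) y (lookup [] (bring m B z S) y) ?ts)"
    "val s x = val t x" "val s y = val t y"
    using expand_complete[OF X(2,3) _ w R(1)] by blast
  have "agree X (fst p) s"
    using expand_sound(4)[OF X(2,3) _ ts s(1)] by auto
  then have "val s z = val t z" using X(5) s p(2) by (cases "z = x") (auto simp: agree_def)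
  moreover have "s \<in> set (candidates m B A (x, y) z S)"
    unfolding candidates_def using s R(2) by (force simp: image_iff)
  ultimately show thesis using that s by blast
qed

text \<open>Since \<open>X\<close> contains both ends of the arc, an exchange that respects
  \<open>X\<close> does not leave \<open>R'\<close>. A stored pair itself need only lie in
  \<open>R\<close>; it is the candidate that brings in the constraint.\<close>

lemma witnesses_restrict_entry_other:
  assumes z: "z \<in> V" "z \<noteq> x" "z \<noteq> y" and X: "x \<in> X" "y \<in> X" and W: "witnesses R X z W"
  shows "witnesses R' X z (restrict_entry m B A (x, y) S z W)"
proof (rule witnessesI)
  have eq: "restrict_entry m B A (x, y) S z W =
      concat (map (\<lambda>t. map (\<lambda>p. (t, m t (fst p) (snd p))) (filter (\<lambda>p. val (fst p) z = val t z) W))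
        (candidates m B A (x, y) z S))"
    using z unfolding restrict_entry_def by simp
  have sub: "R' \<subseteq> R" unfolding R'_def by blast
  show "fst r \<in> R' \<and> snd r \<in> R' \<and> agree X (fst r) (snd r)"
    if r: "r \<in> set (restrict_entry m B A (x, y) S z W)" for r
  proof -
    from r obtain t p where t: "t \<in> set (candidates m B A (x, y) z S)" and p: "p \<in> set W"
      and r: "r = (t, m t (fst p) (snd p))"
      unfolding eq by auto
    have tR: "t \<in> R'" using candidates_sound[of z] z t by blast
    have R: "t \<in> R" "fst p \<in> R" "snd p \<in> R" using tR sub witnessesD1[OF W p] by auto
    have "agree X t (snd r)"
      unfolding r snd_conv by (rule agree_transfer[OF R witnessesD1(3)[OF W p]])
    moreover from this have "snd r \<in> R'"
      using X tR R unfolding R'_def agree_def by (auto simp: r closed)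
    ultimately show ?thesis using tR r by simp
  qed
  fix t u assume tu: "t \<in> R'" "u \<in> R'" "agree X t u"
  obtain p where p: "p \<in> set W" "val (fst p) z = val t z" "val (snd p) z = val u z"
    using witnessesD2[OF W _ _ tu(3)] tu sub by blast
  obtain c where c: "c \<in> set (candidates m B A (x, y) z S)" "val c z = val t z"
    using candidates_complete[of z, OF _ _ tu(1)] z by blast
  have "c \<in> R" using candidates_sound[of z] z c sub by blast
  with witnessesD1[OF W p(1)] have "val (m c (fst p) (snd p)) z = val u z"
    using cancel_left[of c "fst p" "snd p" z] c p by simp
  moreover have "(c, m c (fst p) (snd p)) \<in> set (restrict_entry m B A (x, y) S z W)"
    unfolding eq set_concat set_map using c p by (auto intro!: bexI[of _ c] image_eqI[of _ _ p])
  ultimately show "\<exists>p \<in> set (restrict_entry m B A (x, y) S z W). val (fst p) z = val t z \<and> val (snd p) z = val u z"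
    using c by force
qed

lemma witnesses_restrict_entry_first: "witnesses R' {} x (restrict_entry m B A (x, y) S x W)"
proof (rule witnessesI)
  show "fst r \<in> R' \<and> snd r \<in> R' \<and> agree {} (fst r) (snd r)"
    if "r \<in> set (restrict_entry m B A (x, y) S x W)" for r
    using that candidates_sound[OF xy(1)] by (auto simp: restrict_entry_def agree_def)
  fix t u assume "t \<in> R'" "u \<in> R'"
  then obtain c d where "c \<in> set (candidates m B A (x, y) x S)" "val c x = val t x"
    "d \<in> set (candidates m B A (x, y) x S)" "val d x = val u x"
    using candidates_complete[OF xy(1)] by metis
  then show "\<exists>p \<in> set (restrict_entry m B A (x, y) S x W). val (fst p) x = val t x \<and> val (snd p) x = val u x"
    by (force simp: restrict_entry_def)
qed

text \<open>Candidates taken at \<open>x\<close> realise every pair of values at \<open>x\<close>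
  and \<open>y\<close> occurring in \<open>R'\<close>. So agreement of \<open>t\<close> and
  \<open>u\<close> at \<open>x\<close> passes to the candidates that replace them.\<close>

lemma witnesses_restrict_entry_second:
  assumes "x \<noteq> y"
  shows "witnesses R' {x} y (restrict_entry m B A (x, y) S y W)"
proof (rule witnessesI)
  show "fst r \<in> R' \<and> snd r \<in> R' \<and> agree {x} (fst r) (snd r)"
    if "r \<in> set (restrict_entry m B A (x, y) S y W)" for r
    using that candidates_sound[OF xy(1)] assms by (auto simp: restrict_entry_def agree_def)
  fix t u assume tu: "t \<in> R'" "u \<in> R'" "agree {x} t u"
  then obtain c d where "c \<in> set (candidates m B A (x, y) x S)" "val c x = val t x" "val c y = val t y"
    "d \<in> set (candidates m B A (x, y) x S)" "val d x = val u x" "val d y = val u y"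
    using candidates_complete[OF xy(1)] by metis
  with tu(3) assms show "\<exists>p \<in> set (restrict_entry m B A (x, y) S y W). val (fst p) y = val t y \<and> val (snd p) y = val u y"
    by (force simp: restrict_entry_def agree_def)
qed

lemma represents_restrict_front:
  "represents R' {} (map (\<lambda>e. (fst e, prune B (fst e) (restrict_entry m B A (x, y) S (fst e) (snd e)))) S)"
proof -
  let ?F = "\<lambda>e. (fst e, prune B (fst e) (restrict_entry m B A (x, y) S (fst e) (snd e)))"
  have val_in': "val t z \<in> set B" if "t \<in> R'" "z \<in> V" for t z
    using that val_in unfolding R'_def by blast
  have rest: "represents R' X (map ?F es)"
    if "represents R X es" "x \<in> X" "y \<in> X" "x \<notin> set (map fst es)" "y \<notin> set (map fst es)"
      "set (map fst es) \<subseteq> V" for X es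
    using that
  proof (induction es arbitrary: X)
    case (Cons e es)
    then have "witnesses R' X (fst e) (restrict_entry m B A (x, y) S (fst e) (snd e))"
      by (intro witnesses_restrict_entry_other) auto
    with Cons val_in' show ?case by (simp add: witnesses_prune)
  qed simp
  obtain e es where e: "S = e # es" "fst e = x" "map fst es = zs" using front(1) by (cases S) auto
  have first: "witnesses R' {} x (prune B x (restrict_entry m B A (x, y) S x (snd e)))"
    using xy val_in' by (intro witnesses_prune witnesses_restrict_entry_first)
  have V: "set zs \<subseteq> V" "x \<notin> set zs" "distinct zs" using S e by auto
  show ?thesis
  proof (cases "x = y")
    case True
    have "represents R' {x} (map ?F es)"
      using S(1) e V True by (intro rest) auto
    with first e(1,2) show ?thesis by simp
  next
    case False
    then obtain f fs where f: "es = f # fs" "fst f = y" "map fst fs = tl zs"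
      using e(3) zs_Cons[OF False] by (cases es) auto
    have "zs = y # map fst fs" using e(3) f by simp
    with V have d: "y \<notin> set (map fst fs)" "x \<notin> set (map fst fs)" "set (map fst fs) \<subseteq> V"
      by auto
    have "represents R' {y, x} (map ?F fs)"
      using S(1) e(1,2) f d by (intro rest) auto
    moreover have "witnesses R' {x} y (prune B y (restrict_entry m B A (x, y) S y (snd f)))"
      using xy val_in' by (intro witnesses_prune witnesses_restrict_entry_second False)
    ultimately show ?thesis using first e(1,2) f(1,2) by simp
  qed
qed

end

lemma represents_restrict:
  assumes "x \<in> V" "y \<in> V" "represents R {} S" "distinct (map fst S)" "set (map fst S) = V"
  shows "represents {t \<in> R. (val t x, val t y) \<in> set A} {} (restrict_state m B A (x, y) S)"
    and "distinct (map fst (restrict_state m B A (x, y) S))" "set (map fst (restrict_state m B A (x, y) S)) = V"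
proof -
  let ?S1 = "bring m B y S"
  let ?S2 = "bring m B x ?S1"
  have 1: "represents R {} ?S1" "map fst ?S1 = y # remove1 y (map fst S)"
    using represents_bring[OF assms(3,4)] assms by auto
  then have d1: "distinct (map fst ?S1)" "set (map fst ?S1) = V"
    using assms by auto
  have 2: "represents R {} ?S2" "map fst ?S2 = x # remove1 x (y # remove1 y (map fst S))"
    using represents_bring[OF 1(1) d1(1)] d1 assms 1(2) by auto
  have d2: "distinct (map fst ?S2)" "set (map fst ?S2) = V"
    using 2(2) d1 assms by (auto simp: 1(2))
  have eq: "map fst (restrict_state m B A (x, y) S) = map fst ?S2"
    by (simp add: restrict_state_def)
  show "distinct (map fst (restrict_state m B A (x, y) S))" "set (map fst (restrict_state m B A (x, y) S)) = V"
    unfolding eq using d2 by blast+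
  show "represents {t \<in> R. (val t x, val t y) \<in> set A} {} (restrict_state m B A (x, y) S)"
    using represents_restrict_front[OF assms(1,2) 2(1) d2 2(2)] by (simp add: restrict_state_def)
qed

end

section \<open>Lookup in association lists\<close>

lemma lookup_map: "lookup d (map (\<lambda>x. (x, f x)) xs) x = (if x \<in> set xs then f x else d)"
  by (induction xs) auto

lemma lookup_absent: "x \<notin> set (map fst t) \<Longrightarrow> lookup d t x = d"
  by (induction t) auto

lemma lookup_in: "x \<in> set (map fst t) \<Longrightarrow> (x, lookup d t x) \<in> set t"
  by (induction t) auto

lemma lookup_unique:
  assumes "(x, a) \<in> set t" "\<And>b. (x, b) \<in> set t \<Longrightarrow> b = a"
  shows "lookup d t x = a"
proof -
  have "(x, lookup d t x) \<in> set t" using assms(1) by (intro lookup_in) force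
  then show ?thesis by (rule assms(2))
qed

lemma val_map: "x \<in> set xs \<Longrightarrow> val (map (\<lambda>x. (x, f x)) xs) x = f x"
  by (simp add: val_def lookup_map)

text \<open>Fixing the domain by \<open>map fst t = V\<close> makes all solutions take the default 0
  outside \<open>V\<close>, so the Maltsev identities hold there as well.\<close>

definition solutions ::
  "nat list \<Rightarrow> (nat \<Rightarrow> nat set) \<Rightarrow> (nat \<times> nat) set \<Rightarrow> (nat \<times> nat) set \<Rightarrow> assignment set" where
  "solutions V L A H = {t. map fst t = V \<and> (\<forall>x \<in> set V. val t x \<in> L x) \<and>
     (\<forall>(x, y) \<in> A. (val t x, val t y) \<in> H)}"

section \<open>Correctness for a fixed instance\<close>

context
  fixes G H :: "nat pair_pre_digraph" and L :: "nat \<Rightarrow> nat set" and h :: "nat \<Rightarrow> nat list \<Rightarrow> nat" and k :: nat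
    and V B :: "nat list" and AH LL :: "(nat \<times> nat) list" and T :: "(nat \<times> nat list \<times> nat) list"
  assumes k: "k \<ge> 2" and G: "pair_fin_digraph G" and L: "list_assignment G H L"
    and h: "minority_homomorphism k G H L h"
    and V: "set V = pverts G" "distinct V" and B: "set B = pverts H" and AH: "set AH = parcs H"
    and LL: "set LL = (SIGMA x : pverts G. L x)"
    and T: "set T = {(x, as, h x as) | x as. x \<in> pverts G \<and> as \<in> tuples k (L x)}"
begin

lemma arc_in_V:
  assumes "(x, y) \<in> parcs G"
  shows "x \<in> set V" "y \<in> set V"
proof -
  interpret pair_fin_digraph G by (rule G)
  show "x \<in> set V" "y \<in> set V" using assms in_arcsD1 in_arcsD2 V(1) by simp_all
qed

lemma tuple_in_tuples:
  "a \<in> S \<Longrightarrow> b \<in> S \<Longrightarrow> c \<in> S \<Longrightarrow> a # replicate (k - 2) b @ [c] \<in> tuples k S"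
  using k by (auto simp: tuples_def)

lemma val_maltsev:
  assumes "x \<in> set V" "val t x \<in> L x" "val u x \<in> L x" "val v x \<in> L x"
  shows "val (maltsev k T V t u v) x = h x (val t x # replicate (k - 2) (val u x) @ [val v x])"
proof -
  let ?as = "val t x # replicate (k - 2) (val u x) @ [val v x]"
  have "?as \<in> tuples k (L x)" using assms(2-) by (rule tuple_in_tuples)
  then have "(x, ?as, h x ?as) \<in> set T" using assms(1) V(1) unfolding T by blast
  then have "((x, ?as), h x ?as) \<in> set (map (\<lambda>(y, as, c). ((y, as), c)) T)"
    unfolding set_map by (rule image_eqI[rotated]) simp
  moreover have "c = h x as" if "((x, as), c) \<in> set (map (\<lambda>(y, as, c). ((y, as), c)) T)" for as c
    using that T by auto
  ultimately have "lookup 0 (map (\<lambda>(y, as, c). ((y, as), c)) T) (x, ?as) = h x ?as"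
    by (rule lookup_unique)
  then show ?thesis
    unfolding maltsev_def val_map[OF assms(1)] .
qed

text \<open>Closure is the list and adjacency properties of \<open>h\<close>, applied to tuples
  built from three solutions. The two Maltsev identities are the minority condition with the
  exceptional coordinate in first and in last place.\<close>

lemma maltsev_relation_solutions:
  assumes A: "A \<subseteq> parcs G"
  shows "maltsev_relation (maltsev k T V) (solutions V L A (set AH)) (set V) B"
proof
  let ?R = "solutions V L A (set AH)"
  obtain n where n: "k = Suc (Suc n)" using k by (metis add_2_eq_Suc le_Suc_ex)
  have arc: "x \<in> set V" "y \<in> set V" if "(x, y) \<in> A" for x y
    using that A arc_in_V by blast+
  have outside: "val t x = 0" if "map fst t = V" "x \<notin> set V" for t x
    using that lookup_absent unfolding val_def by metis
  have fst_m: "map fst (maltsev k T V t u v) = V" for t u v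
    by (simp add: maltsev_def o_def)
  fix t u v assume R: "t \<in> ?R" "u \<in> ?R" "v \<in> ?R"
  have m: "val (maltsev k T V t u v) x = h x (val t x # replicate n (val u x) @ [val v x])"
    if "x \<in> set V" for x
    using val_maltsev[OF that, of t u v] that R n unfolding solutions_def by simp
  have tup: "val t x # replicate n (val u x) @ [val v x] \<in> tuples k (L x)" if "x \<in> set V" for x
    using tuple_in_tuples[of "val t x" "L x" "val u x" "val v x"] that R n unfolding solutions_def by simp
  have consistent: "consistent_homomorphism k G H L h"
    using h unfolding minority_homomorphism_def by blast
  have minority: "h x ((replicate k b)[i := a]) = a" if "x \<in> set V" "a \<in> L x" "b \<in> L x" "i < k" for x a b i
    using h that V(1) unfolding minority_homomorphism_def by blast
  show "maltsev k T V t u v \<in> ?R"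
    unfolding solutions_def
  proof (intro CollectI conjI ballI)
    show "val (maltsev k T V t u v) x \<in> L x" if "x \<in> set V" for x
      unfolding m[OF that] using consistent tup[OF that] that V(1)
      unfolding consistent_homomorphism_def by blast
    show "case p of (x, y) \<Rightarrow> (val (maltsev k T V t u v) x, val (maltsev k T V t u v) y) \<in> set AH"
      if "p \<in> A" for p
    proof -
      obtain x y where p: "p = (x, y)" by (cases p)
      with that have xy: "(x, y) \<in> A" by simp
      let ?as = "\<lambda>x. val t x # replicate n (val u x) @ [val v x]"
      \<comment> \<open>Each coordinate of the two tuples comes from one of \<open>t\<close>,
        \<open>u\<close>, \<open>v\<close>, and each of these maps the arc to an arc of
        \<open>H\<close>.\<close>
      have "list_all2 (\<lambda>a b. (a, b) \<in> parcs H) (?as x) (?as y)"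
      proof -
        have uniform: "list_all2 P (replicate n a) (replicate n b)" if "P a b" for P and a b :: nat
          using that by (simp add: list_all2_conv_all_nth)
        have "(val w x, val w y) \<in> parcs H" if "w \<in> ?R" for w
          using that xy AH unfolding solutions_def by blast
        with R show ?thesis by (simp add: list_all2_append uniform)
      qed
      then have "\<forall>i < k. (?as x ! i, ?as y ! i) \<in> parcs H"
        unfolding list_all2_conv_all_nth by (simp add: n)
      moreover have "(x, y) \<in> parcs G" using xy A by blast
      ultimately have "(h x (?as x), h y (?as y)) \<in> parcs H"
        using consistent tup[OF arc(1)[OF xy]] tup[OF arc(2)[OF xy]]
        unfolding consistent_homomorphism_def by blast
      then show ?thesis
        using p m[OF arc(1)[OF xy]] m[OF arc(2)[OF xy]] AH by simp
    qed
  qed (rule fst_m)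
  fix x
  show "val (maltsev k T V t u v) x = val t x" if "val u x = val v x"
  proof (cases "x \<in> set V")
    case True
    have "val t x # replicate n (val u x) @ [val u x] = (replicate k (val u x))[0 := val t x]"
      by (simp add: n replicate_append_same)
    with minority[OF True, of "val t x" "val u x" 0] True R k show ?thesis
      unfolding m[OF True] that[symmetric] solutions_def by simp
  next
    case False
    with outside[OF fst_m] outside[of t] R show ?thesis unfolding solutions_def by simp
  qed
  show "val (maltsev k T V t u v) x = val v x" if "val t x = val u x"
  proof (cases "x \<in> set V")
    case True
    have "(replicate (Suc n) (val u x) @ [val u x])[Suc n := val v x] = replicate (Suc n) (val u x) @ [val v x]"
      by (metis length_replicate list_update_length)
    moreover have "replicate k (val u x) = replicate (Suc n) (val u x) @ [val u x]"
      by (simp add: n replicate_append_same)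
    ultimately have "val u x # replicate n (val u x) @ [val v x] = (replicate k (val u x))[k - 1 := val v x]"
      by (simp only: n diff_Suc_1 replicate_Suc append_Cons)
    with minority[OF True, of "val v x" "val u x" "k - 1"] True R k show ?thesis
      unfolding m[OF True] that solutions_def by simp
  next
    case False
    with outside[OF fst_m] outside[of v] R show ?thesis unfolding solutions_def by simp
  qed
next
  show "val t x \<in> set B" if "t \<in> solutions V L A (set AH)" "x \<in> set V" for t x
    using that L B V(1) unfolding solutions_def list_assignment_def by blast
qed

lemma set_values_at: "x \<in> pverts G \<Longrightarrow> set (values_at LL x) = L x"
  using LL by (force simp: values_at_def)

lemma val_start: "y \<in> set V \<Longrightarrow> val (start V LL x a) y = (if y = x then a else lookup 0 LL y)"
  unfolding val_def start_def by (simp add: lookup_map)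

lemma represents_init:
  assumes ne: "\<And>x. x \<in> set V \<Longrightarrow> x \<in> set (map fst LL)"
  shows "represents (solutions V L {} (set AH)) {} (init V LL)"
proof -
  let ?R = "solutions V L {} (set AH)"
  have L0: "lookup 0 LL x \<in> L x" if "x \<in> set V" for x
    using lookup_in[OF ne[OF that]] LL by auto
  let ?W = "\<lambda>x. map (\<lambda>p. (start V LL x (fst p), start V LL x (snd p)))
     (List.product (values_at LL x) (values_at LL x))"
  have wit: "witnesses ?R X x (?W x)" if x: "x \<in> set V" and X: "x \<notin> X" for x X
  proof (rule witnessesI)
    have start: "start V LL x a \<in> ?R" if "a \<in> L x" for a
      using that L0 by (auto simp: solutions_def val_start) (simp add: start_def o_def)
    have agree: "agree X (start V LL x a) (start V LL x b)" for a b
      using X by (auto simp: agree_def val_def start_def lookup_map)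
    show "fst r \<in> ?R \<and> snd r \<in> ?R \<and> agree X (fst r) (snd r)" if "r \<in> set (?W x)" for r
      using that start agree x V(1) by (auto simp: set_values_at)
    fix t u assume "t \<in> ?R" "u \<in> ?R"
    with x have "val t x \<in> L x" "val u x \<in> L x" unfolding solutions_def by auto
    with x V(1) have "(val t x, val u x) \<in> set (List.product (values_at LL x) (values_at LL x))"
      by (simp add: set_values_at)
    then have "(start V LL x (val t x), start V LL x (val u x)) \<in> set (?W x)"
      unfolding set_map by (rule image_eqI[rotated]) simp
    with x show "\<exists>p \<in> set (?W x). val (fst p) x = val t x \<and> val (snd p) x = val u x"
      by (intro bexI) (auto simp: val_start)
  qed
  have "represents ?R X (map (\<lambda>x. (x, ?W x)) xs)" if "set xs \<subseteq> set V" "distinct xs" "X \<inter> set xs = {}" for X xs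
    using that by (induction xs arbitrary: X) (auto intro!: wit)
  from this[of V "{}"] V(2) show ?thesis by (simp add: init_def)
qed

text \<open>Induction over the arcs: the arcs of the tail have been imposed already, and the head
  arc cuts their set of solutions down to the next one.\<close>

lemma represents_foldr_restrict:
  assumes ne: "\<And>x. x \<in> set V \<Longrightarrow> x \<in> set (map fst LL)" and A: "set A \<subseteq> parcs G"
  defines "S \<equiv> foldr (restrict_state (maltsev k T V) B AH) A (init V LL)"
  shows "represents (solutions V L (set A) (set AH)) {} S \<and> distinct (map fst S) \<and> set (map fst S) = set V"
  unfolding S_def using A
proof (induction A)
  case Nil
  show ?case using represents_init[OF ne] V(2) by (simp add: init_def o_def)
next
  case (Cons a A)
  obtain x y where a: "a = (x, y)" by (cases a)
  interpret maltsev_relation "maltsev k T V" "solutions V L (set A) (set AH)" "set V" B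
    using Cons.prems by (intro maltsev_relation_solutions) simp
  have "x \<in> set V" "y \<in> set V"
    using Cons.prems a arc_in_V by auto
  moreover have "solutions V L (set (a # A)) (set AH) =
      {t \<in> solutions V L (set A) (set AH). (val t x, val t y) \<in> set AH}"
    unfolding solutions_def a by auto
  ultimately show ?case
    using Cons represents_restrict[of x y _ AH] by (simp add: a del: set_map)
qed

text \<open>A member of the relation needs a witness for its value at each variable, so an empty
  entry means that there are no solutions. Conversely, a pair stored in the first entry consists of
  solutions.\<close>

lemma decide_iff:
  assumes A: "set A = parcs G"
  shows "decide k B AH V A LL T \<longleftrightarrow> (\<exists>g. list_homomorphism G H L g)"
proof (cases "\<forall>x \<in> set V. x \<in> set (map fst LL)")
  case True
  let ?R = "solutions V L (set A) (set AH)"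
  let ?S = "foldr (restrict_state (maltsev k T V) B AH) A (init V LL)"
  have S: "represents ?R {} ?S" "set (map fst ?S) = set V" "distinct (map fst ?S)"
    using represents_foldr_restrict[OF _ equalityD1[OF A]] True by blast+
  have empty: "?R = {}" if "e \<in> set ?S" "snd e = []" for e
  proof -
    from that(1) have "fst e \<in> set (map fst ?S)" by simp
    then obtain zs zs' where "map fst ?S = zs @ fst e # zs'"
      using split_list by fast
    with S(1,3) have "witnesses ?R ({} \<union> set zs) (fst e) (lookup [] ?S (fst e))"
      by (intro witnesses_lookup)
    moreover have "lookup [] ?S (fst e) = []"
    proof (rule lookup_unique)
      from that(1) have "(fst e, snd e) \<in> set ?S" by simp
      with that(2) show e: "(fst e, []) \<in> set ?S" by simp
      show "b = []" if "(fst e, b) \<in> set ?S" for b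
        using eq_key_imp_eq_value[OF S(3) that e] .
    qed
    ultimately have W: "witnesses ?R (set zs) (fst e) []" by simp
    show ?thesis
    proof (rule ccontr)
      assume "?R \<noteq> {}"
      then obtain t where "t \<in> ?R" by blast
      from witnesses_value[OF W this] show False by simp
    qed
  qed
  have "decide k B AH V A LL T \<longleftrightarrow> ?R \<noteq> {}"
  proof
    assume "decide k B AH V A LL T"
    then have ne: "\<forall>e \<in> set ?S. snd e \<noteq> []" unfolding decide_def by blast
    show "?R \<noteq> {}"
    proof (cases ?S)
      \<comment> \<open>Without vertices there are no arcs either, and the empty assignment is a
        solution.\<close>
      case Nil
      with S(2) have "V = []" by simp
      moreover from this have "set A = {}" using A arc_in_V(1) by auto
      ultimately have "[] \<in> ?R" unfolding solutions_def by simp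
      then show ?thesis by blast
    next
      case (Cons e es)
      with ne S(1) obtain p where "p \<in> set (snd e)" "witnesses ?R {} (fst e) (snd e)"
        by (cases "snd e") auto
      then show ?thesis using witnessesD1(1) by blast
    qed
  next
    assume "?R \<noteq> {}"
    with empty True show "decide k B AH V A LL T" unfolding decide_def by blast
  qed
  also have "\<dots> \<longleftrightarrow> (\<exists>g. list_homomorphism G H L g)"
  proof
    assume "?R \<noteq> {}"
    then obtain t where "t \<in> ?R" by blast
    then have "list_homomorphism G H L (val t)"
      using V(1) A AH unfolding solutions_def list_homomorphism_def by auto
    then show "\<exists>g. list_homomorphism G H L g" by blast
  next
    assume "\<exists>g. list_homomorphism G H L g"
    then obtain g where g: "list_homomorphism G H L g" by blast
    let ?t = "map (\<lambda>x. (x, g x)) V"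
    have "val ?t x = g x" if "x \<in> set V" for x
      using that by (rule val_map)
    moreover have "x \<in> set V" "y \<in> set V" if "(x, y) \<in> set A" for x y
      using that A arc_in_V by blast+
    ultimately have "?t \<in> ?R"
      using g V(1) A AH unfolding solutions_def list_homomorphism_def by (auto simp: o_def)
    then show "?R \<noteq> {}" by blast
  qed
  finally show ?thesis .
next
  case False
  then obtain x where "x \<in> set V" "x \<notin> set (map fst LL)" by blast
  then have "L x = {}" "x \<in> pverts G" using LL V(1) by force+
  then have "\<not> (\<exists>g. list_homomorphism G H L g)"
    unfolding list_homomorphism_def by blast
  with False show ?thesis unfolding decide_def by blast
qed

end

section \<open>From feasible functions to polynomial-time decidability\<close>

lemma poly_time_decidable_if_feasible:
  fixes f :: "'s :: code \<Rightarrow> bool"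
  assumes f: "feasible [enc] f"
    and code: "\<And>i t. promise i \<Longrightarrow> encodes i t \<Longrightarrow> \<exists>s. t = enc s \<and> (f s \<longleftrightarrow> yes i)"
  shows "poly_time_decidable promise encodes yes"
proof -
  \<comment> \<open>Prefix length 1 reserves position 0 for \<open>e\<close> itself, the function
    that a run calls on the input.\<close>
  obtain Q e c where c: "poly_bounded [enc] c" and Q: "computes [enc] 1 Q e f c"
    using feasibleE[OF f] by blast
  from c obtain d where d: "\<And>s. c s \<le> (2 + size (enc s)) ^ d"
    unfolding poly_bounded_def env_size_def by auto
  \<comment> \<open>As a polynomial this is \<open>3 + (2 + x) ^ d\<close>. The power bounds the
    cost of the body, and the constant covers the initial call and its argument.\<close>
  let ?q = "[:3 :: nat:] + [:2, 1:] ^ d"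
  have "\<exists>out n. runs (e # Q) t out n \<and> n \<le> poly ?q (size t) \<and> (out \<noteq> Dnil \<longleftrightarrow> yes i)"
    if it: "promise i" "encodes i t" for i t
  proof -
    from code[OF it] obtain s where s: "t = enc s" "f s \<longleftrightarrow> yes i" by blast
    have "eval_within (e # Q) [t] e (enc (f s)) (c s)"
      using computesD[OF Q, of "[e]" "[]" s] s(1) by simp
    then have "eval_within (e # Q) [t] (Call 0 [Var 0]) (enc (f s)) (Suc (Suc 0 + 0 + c s))"
      by (intro eval_within_Call[OF evals_within_Cons[OF eval_within_Var evals_within_Nil]]) simp_all
    then obtain n where n: "runs (e # Q) t (enc (f s)) n" "n \<le> Suc (Suc (c s))"
      unfolding runs_def eval_within_def by auto
    have "n \<le> poly ?q (size t)"
      using n(2) d[of s] s(1) by (simp add: poly_power)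
    moreover have "enc (f s) \<noteq> Dnil \<longleftrightarrow> yes i"
      using s(2) by (cases "f s") simp_all
    ultimately show ?thesis using n(1) by blast
  qed
  then show ?thesis unfolding poly_time_decidable_def by blast
qed

lemma codes_eq_enc: "nat_code = enc" "list_code enc = enc" "pair_code enc enc = enc"
  by (simp_all add: fun_eq_iff enc_nat_def enc_list_def enc_prod_def)

text \<open>\<open>H\<close> and \<open>k\<close> are fixed before the program is chosen, so lists
  of the vertices and arcs of \<open>H\<close> may be built into it; the input consists of
  \<open>G\<close>, \<open>L\<close> and \<open>h\<close>.\<close>

theorem theorem2:
  fixes H :: "nat pair_pre_digraph" and k :: nat
  assumes "pair_fin_digraph H" and "k \<ge> 2"
  shows "poly_time_decidable
    (\<lambda>(G, L, h). pair_fin_digraph G \<and> list_assignment G H L \<and> minority_homomorphism k G H L h)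
    (instance_encoding k)
    (\<lambda>(G, L, h). \<exists>g. list_homomorphism G H L g)"
proof -
  have "finite (pverts H)" "finite (parcs H)"
    using assms(1) by (simp_all add: pair_fin_digraph_def pair_fin_digraph_axioms_def)
  then obtain B AH where B: "set B = pverts H" and AH: "set AH = parcs H"
    by (metis finite_list)
  show ?thesis
  proof (rule poly_time_decidable_if_feasible)
    let ?f = "\<lambda>s. decide k B AH (fst s) (fst (snd s)) (fst (snd (snd s))) (snd (snd (snd s)))"
    have "feasible [enc] (\<lambda>s. s :: nat list \<times> (nat \<times> nat) list \<times> (nat \<times> nat) list \<times> (nat \<times> nat list \<times> nat) list)"
      by (rule feasible_env) simp
    then show "feasible [enc] ?f" by (intro feas)
    fix i :: "nat pair_pre_digraph \<times> (nat \<Rightarrow> nat set) \<times> (nat \<Rightarrow> nat list \<Rightarrow> nat)" and t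
    obtain G L h where i: "i = (G, L, h)" by (cases i)
    assume "case i of (G, L, h) \<Rightarrow> pair_fin_digraph G \<and> list_assignment G H L \<and> minority_homomorphism k G H L h"
    then have G: "pair_fin_digraph G" "list_assignment G H L" "minority_homomorphism k G H L h"
      unfolding i by simp_all
    assume "instance_encoding k i t"
    then obtain V A LL T where V: "distinct V" "set V = pverts G" and A: "set A = parcs G"
      and LL: "set LL = (SIGMA x : pverts G. L x)"
      and T: "set T = {(x, as, h x as) | x as. x \<in> pverts G \<and> as \<in> tuples k (L x)}"
      and "t = Dcons (enc V) (Dcons (enc A) (Dcons (enc LL) (enc T)))"
      unfolding i instance_encoding_def set_encoding_def prod.case codes_eq_enc by blast
    then have t: "t = enc (V, A, LL, T)" by simp
    show "\<exists>s. t = enc s \<and> (?f s \<longleftrightarrow> (case i of (G, L, h) \<Rightarrow> \<exists>g. list_homomorphism G H L g))"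
      using decide_iff[OF assms(2) G V(2,1) B AH LL T A] t unfolding i by (intro exI[of _ "(V, A, LL, T)"]) simp
  qed
qed

end
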